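(* Let $\alpha_0,\dots,\alpha_5\in\mathbb{C}$ satisfy $\alpha_0+\alpha_1+2\alpha_2+2\alpha_3+\alpha_4+\alpha_5=1$. Consider a polynomial Hamiltonian system $$\frac{dx}{dt}=\frac{\partial H}{\partial y},\quad \frac{dy}{dt}=-\frac{\partial H}{\partial x},\quad \frac{dz}{dt}=\frac{\partial H}{\partial w},\quad \frac{dw}{dt}=-\frac{\partial H}{\partial z}$$ with Hamiltonian $H\in\mathbb{C}(t)[x,y,z,w]$. Assume that (A1) $H$ has degree at most $6$ with respect to $x,y,z,w$; (A2) this system becomes again a polynomial Hamiltonian system in each of the following coordinate systems $(x_i,y_i,z_i,w_i)$, $i=0,1,\dots,5$: $$\begin{aligned} &x_0=1/x,\ y_0=-((y+t)x+\alpha_0)x,\ z_0=z,\ w_0=w,\\ &x_1=1/x,\ y_1=-(yx+\alpha_1)x,\ z_1=z,\ w_1=w,\\ &x_2=-((x-z)y-\alpha_2)y,\ y_2=1/y,\ z_2=z,\ w_2=w+y,\\ &x_3=x,\ y_3=y,\ z_3=1/z,\ w_3=-(wz+\alpha_3)z,\\ &x_4=x,\ y_4=y,\ z_4=-((z-1)w-\alpha_4)w,\ w_4=1/w,\\ &x_5=x,\ y_5=y,\ z_5=-(zw-\alpha_5)w,\ w_5=1/w. \end{aligned}$$ Then the system coincides with $$\begin{aligned} \frac{dx}{dt} &=\frac{2x^2y}{t}+x^2-\frac{2xy}{t}-\left(1+\frac{2\alpha_2+2\alpha_3+\alpha_5+\alpha_4}{t}\right)x+\frac{\alpha_2+\alpha_5}{t}+\frac{2z((z-1)w+\alpha_3)}{t},\\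 \frac{dy}{dt} &=-\frac{2xy^2}{t}+\frac{y^2}{t}-2xy+\left(1+\frac{2\alpha_2+2\alpha_3+\alpha_5+\alpha_4}{t}\right)y-\alpha_1,\\ \frac{dz}{dt} &=\frac{2z^2w}{t}+z^2-\frac{2zw}{t}-\left(1+\frac{\alpha_5+\alpha_4}{t}\right)z+\frac{\alpha_5}{t}+\frac{2yz(z-1)}{t},\\ \frac{dw}{dt} &=-\frac{2zw^2}{t}+\frac{w^2}{t}-2zw+\left(1+\frac{\alpha_5+\alpha_4}{t}\right)w-\alpha_3-\frac{2y(-w+2zw+\alpha_3)}{t}. \end{aligned}$$
   Context: "The system becomes again a polynomial Hamiltonian system in $(x_i,y_i,z_i,w_i)$" means that, rewritten in these coordinates, it takes the form $dx_i/dt=\partial K_i/\partial y_i$, $dy_i/dt=-\partial K_i/\partial x_i$, $dz_i/dt=\partial K_i/\partial w_i$, $dw_i/dt=-\partial K_i/\partial z_i$ for some $K_i\in\mathbb{C}(t)[x_i,y_i,z_i,w_i]$. *)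

theory Defs
  imports "HOL-Computational_Algebra.Computational_Algebra"
begin

section \<open>Derivations and their extension to the field of fractions\<close>

definition derivation :: "('a::comm_ring_1 \<Rightarrow> 'a) \<Rightarrow> bool" where
  "derivation d \<longleftrightarrow> (\<forall>a b. d (a + b) = d a + d b) \<and> (\<forall>a b. d (a * b) = d a * b + a * d b)"

text \<open>The quotient rule. The description is well defined when \<open>d\<close> is a derivation, see
  \<open>fract_deriv_Fract\<close> below; it is only used for such \<open>d\<close>.\<close>

definition fract_deriv :: "('a::idom \<Rightarrow> 'a) \<Rightarrow> 'a fract \<Rightarrow> 'a fract" where
  "fract_deriv d q =
    (THE r. \<forall>a b. b \<noteq> 0 \<and> q = Fract a b \<longrightarrow> r = Fract (d a * b - a * d b) (b * b))"

lemma derivation_0: "derivation d \<Longrightarrow> d 0 = 0"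
  unfolding derivation_def by (metis add_cancel_right_left add.right_neutral)

lemma derivation_1: "derivation d \<Longrightarrow> d 1 = 0"
  unfolding derivation_def by (metis add_cancel_right_right mult_1 mult.right_neutral)

lemma fract_deriv_Fract:
  fixes d :: "'a::idom \<Rightarrow> 'a"
  assumes d: "derivation d" and b: "b \<noteq> 0"
  shows "fract_deriv d (Fract a b) = Fract (d a * b - a * d b) (b * b)"
  unfolding fract_deriv_def
proof (rule the_equality)
  show "\<forall>a' b'. b' \<noteq> 0 \<and> Fract a b = Fract a' b' \<longrightarrow>
          Fract (d a * b - a * d b) (b * b) = Fract (d a' * b' - a' * d b') (b' * b')"
  proof (intro allI impI)
    fix a' b' assume *: "b' \<noteq> 0 \<and> Fract a b = Fract a' b'"
    hence e: "a * b' = a' * b" using b Fraction_Field.eq_fract(1)[of b b' a a'] by blast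
    have "d (a * b') = d (a' * b)" using e by simp
    hence e2: "d a * b' + a * d b' = d a' * b + a' * d b"
      using d by (simp add: derivation_def)
    have "(d a * b - a * d b) * (b' * b') - (d a' * b' - a' * d b') * (b * b)
        = b * b' * ((d a * b' + a * d b') - (d a' * b + a' * d b))
          - (a * b' - a' * b) * (b * d b' + b' * d b)"
      by (simp add: algebra_simps)
    also have "\<dots> = 0" using e e2 by simp
    finally show "Fract (d a * b - a * d b) (b * b) = Fract (d a' * b' - a' * d b') (b' * b')"
      using * b by (simp add: Fraction_Field.eq_fract)
  qed
next
  fix r assume "\<forall>a' b'. b' \<noteq> 0 \<and> Fract a b = Fract a' b' \<longrightarrow>
          r = Fract (d a' * b' - a' * d b') (b' * b')"
  thus "r = Fract (d a * b - a * d b) (b * b)" using b by blast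
qed

lemma derivation_fract_deriv:
  fixes d :: "'a::idom \<Rightarrow> 'a"
  assumes d: "derivation d"
  shows "derivation (fract_deriv d)"
  unfolding derivation_def
proof (intro conjI allI)
  have dm: "d (a * b) = d a * b + a * d b" and da: "d (a + b) = d a + d b" for a b
    using d by (simp_all add: derivation_def)
  fix p q :: "'a fract"
  obtain a b where p: "p = Fract a b" "b \<noteq> 0" by (cases p)
  obtain c e where q: "q = Fract c e" "e \<noteq> 0" by (cases q)
  show "fract_deriv d (p + q) = fract_deriv d p + fract_deriv d q"
    using p q by (simp add: fract_deriv_Fract[OF d] Fraction_Field.eq_fract dm da) (simp add: algebra_simps)
  show "fract_deriv d (p * q) = fract_deriv d p * q + p * fract_deriv d q"
    using p q by (simp add: fract_deriv_Fract[OF d] Fraction_Field.eq_fract dm da) (simp add: algebra_simps)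
qed

lemma derivation_pderiv: "derivation (pderiv :: 'a::idom poly \<Rightarrow> 'a poly)"
  by (simp add: derivation_def pderiv_add pderiv_mult algebra_simps)

lemma derivation_map_poly:
  fixes d :: "'a::comm_ring_1 \<Rightarrow> 'a"
  assumes d: "derivation d"
  shows "derivation (map_poly d)"
proof -
  have dm: "d (a * b) = d a * b + a * d b" and da: "d (a + b) = d a + d b" for a b
    using d by (simp_all add: derivation_def)
  have ds: "d (sum f A) = (\<Sum>i\<in>A. d (f i))" if "finite A" for f and A :: "nat set"
    using that by (induction A rule: finite_induct) (simp_all add: derivation_0[OF d] da)
  show ?thesis
    unfolding derivation_def
    by (auto simp: poly_eq_iff coeff_map_poly derivation_0[OF d] da dm coeff_mult ds
        sum.distrib)
qed

section \<open>The rings \<open>\<complex>(t)\<close>, \<open>\<complex>(t)[x,y,z,w]\<close> and the field \<open>\<complex>(t)(x,y,z,w)\<close>\<close>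

text \<open>\<open>\<complex>(t)[x,y,z,w]\<close> is the iterated polynomial ring \<open>\<complex>(t)[x][y][z][w]\<close>: the innermost
  variable is \<open>x\<close>, the outermost one is \<open>w\<close>.\<close>

type_synonym ct = "complex poly fract"
type_synonym pol4 = "ct poly poly poly poly"
type_synonym rat4 = "pol4 fract"

definition coeff4 :: "'a::zero poly poly poly poly \<Rightarrow> nat \<Rightarrow> nat \<Rightarrow> nat \<Rightarrow> nat \<Rightarrow> 'a" where
  "coeff4 p i j k l = coeff (coeff (coeff (coeff p l) k) j) i"
    \<comment> \<open>the coefficient of \<open>x^i y^j z^k w^l\<close>\<close>

definition total_degree_le :: "'a::zero poly poly poly poly \<Rightarrow> nat \<Rightarrow> bool" where
  "total_degree_le p n \<longleftrightarrow> (\<forall>i j k l. coeff4 p i j k l \<noteq> 0 \<longrightarrow> i + j + k + l \<le> n)"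

definition const4 :: "ct \<Rightarrow> rat4" where
  "const4 c = to_fract [:[:[:[:c:]:]:]:]"

definition cc :: "complex \<Rightarrow> rat4" where
  "cc a = const4 (to_fract [:a:])"

definition vt :: rat4 where "vt = const4 (to_fract [:0, 1:])"
definition vx :: rat4 where "vx = to_fract [:[:[:[:0, 1:]:]:]:]"
definition vy :: rat4 where "vy = to_fract [:[:[:0, 1:]:]:]"
definition vz :: rat4 where "vz = to_fract [:[:0, 1:]:]"
definition vw :: rat4 where "vw = to_fract [:0, 1:]"

definition eval4 :: "pol4 \<Rightarrow> rat4 \<Rightarrow> rat4 \<Rightarrow> rat4 \<Rightarrow> rat4 \<Rightarrow> rat4" where
  "eval4 p a b c d =
    poly (map_poly (\<lambda>q. poly (map_poly (\<lambda>r. poly (map_poly (\<lambda>s. poly (map_poly const4 s) a) r) b) q) c) p) d"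

definition d_t :: "pol4 \<Rightarrow> pol4" where
  "d_t = map_poly (map_poly (map_poly (map_poly (fract_deriv pderiv))))"
definition d_x :: "pol4 \<Rightarrow> pol4" where "d_x = map_poly (map_poly (map_poly pderiv))"
definition d_y :: "pol4 \<Rightarrow> pol4" where "d_y = map_poly (map_poly pderiv)"
definition d_z :: "pol4 \<Rightarrow> pol4" where "d_z = map_poly pderiv"
definition d_w :: "pol4 \<Rightarrow> pol4" where "d_w = pderiv"

lemma derivation_d:
  "derivation d_t" "derivation d_x" "derivation d_y" "derivation d_z" "derivation d_w"
  unfolding d_t_def d_x_def d_y_def d_z_def d_w_def
  by (intro derivation_map_poly derivation_fract_deriv derivation_pderiv)+

section \<open>Polynomial Hamiltonian systems and changes of coordinates\<close>

text \<open>The derivative \<open>dq/dt\<close> of \<open>q \<in> \<complex>(t)(x,y,z,w)\<close> along the solutions of the Hamiltonian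
  system with Hamiltonian \<open>H\<close>, including the explicit dependence of \<open>q\<close> on \<open>t\<close>.\<close>

definition ddt :: "pol4 \<Rightarrow> rat4 \<Rightarrow> rat4" where
  "ddt H q = fract_deriv d_t q
     + fract_deriv d_x q * to_fract (d_y H) - fract_deriv d_y q * to_fract (d_x H)
     + fract_deriv d_z q * to_fract (d_w H) - fract_deriv d_w q * to_fract (d_z H)"

text \<open>The system with Hamiltonian \<open>H\<close>, rewritten in the coordinates \<open>(x', y', z', w')\<close>, is again
  a polynomial Hamiltonian system.\<close>

definition polynomial_hamiltonian_in ::
    "pol4 \<Rightarrow> rat4 \<Rightarrow> rat4 \<Rightarrow> rat4 \<Rightarrow> rat4 \<Rightarrow> bool" where
  "polynomial_hamiltonian_in H x' y' z' w' \<longleftrightarrow>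
    (\<exists>K :: pol4.
       ddt H x' = eval4 (d_y K) x' y' z' w' \<and>
       ddt H y' = - eval4 (d_x K) x' y' z' w' \<and>
       ddt H z' = eval4 (d_w K) x' y' z' w' \<and>
       ddt H w' = - eval4 (d_z K) x' y' z' w')"

lemma ddt_vars:
  "ddt H vt = 1" "ddt H vx = to_fract (d_y H)" "ddt H vy = - to_fract (d_x H)"
  "ddt H vz = to_fract (d_w H)" "ddt H vw = - to_fract (d_z H)"
proof -
  have F: "fract_deriv pderiv (to_fract p) = to_fract (pderiv p)" for p :: "complex poly"
    by (simp add: to_fract_def fract_deriv_Fract derivation_pderiv)
  have E: "fract_deriv d (to_fract p) = to_fract (d p)" if "derivation d" for d and p :: pol4
    using that by (simp add: to_fract_def fract_deriv_Fract derivation_1)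
  note z = derivation_0[OF derivation_fract_deriv[OF derivation_pderiv]]
    derivation_1[OF derivation_fract_deriv[OF derivation_pderiv]]
  show "ddt H vt = 1" "ddt H vx = to_fract (d_y H)" "ddt H vy = - to_fract (d_x H)"
    "ddt H vz = to_fract (d_w H)" "ddt H vw = - to_fract (d_z H)"
    unfolding ddt_def vt_def vx_def vy_def vz_def vw_def const4_def
    by (simp_all only: E derivation_d)
       (simp_all add: d_t_def d_x_def d_y_def d_z_def d_w_def map_poly_pCons map_poly_1 pderiv_pCons F z
          flip: one_pCons)
qed

lemma eval4_vars:
  "eval4 [:[:[:[:0, 1:]:]:]:] a b c d = a" "eval4 [:[:[:0, 1:]:]:] a b c d = b"
  "eval4 [:[:0, 1:]:] a b c d = c" "eval4 [:0, 1:] a b c d = d"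
  "eval4 [:[:[:[:r:]:]:]:] a b c d = const4 r"
proof -
  have c: "const4 0 = 0" "const4 1 = 1"
    by (simp_all add: const4_def flip: one_pCons)
  show "eval4 [:[:[:[:0, 1:]:]:]:] a b c d = a" "eval4 [:[:[:0, 1:]:]:] a b c d = b"
    "eval4 [:[:0, 1:]:] a b c d = c" "eval4 [:0, 1:] a b c d = d"
    "eval4 [:[:[:[:r:]:]:]:] a b c d = const4 r"
    by (simp_all add: eval4_def map_poly_pCons c)
qed

end

theory Submission
  imports Defs
begin

text \<open>
  Each chart of the theorem resolves one point at infinity of a plane with canonical coordinates
  \<open>X, Y\<close>: it replaces them by \<open>1/X\<close> and \<open>-(X (Y - a) + \<beta>) X\<close>. Here \<open>(X, Y)\<close> is \<open>(x, y)\<close> with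
  \<open>a = 0\<close> and \<open>a = -t\<close>, \<open>(w, z)\<close> with \<open>a = 0\<close> and \<open>a = 1\<close>, \<open>(z, w)\<close> with \<open>a = 0\<close>, and
  \<open>(y, x - z)\<close> with \<open>a = 0\<close>, the last one while \<open>z\<close> and \<open>w + y\<close> are held fixed. The
  transformed equation for \<open>-(X (Y - a) + \<beta>) X\<close> says that
  \<open>X^2 G_X - (2 X (Y - a) + \<beta>) G_Y - e X^2\<close> is a polynomial in the new coordinates, where \<open>G\<close> is the
  Hamiltonian and \<open>e\<close> accounts for the motion of the point (\<open>e = 1\<close> for \<open>a = -t\<close>, otherwise
  \<open>e = 0\<close>).

  Use \<open>X\<close> and \<open>s = X (Y - a) + \<beta>\<close> as independent variables. A polynomial in \<open>1/X\<close> and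
  \<open>-s X\<close> has at \<open>X^q\<close>, \<open>q > 0\<close>, a coefficient divisible by \<open>s^q\<close>. If \<open>X^p P_p(s)\<close> are the weight
  parts of \<open>G\<close>, the expression above has the coefficient \<open>p P_p - s P_p' - [p = 1] e\<close> at
  \<open>X^(p + 1)\<close>. Comparing powers of \<open>s\<close> yields that \<open>P_p\<close> vanishes modulo \<open>s^p\<close> for \<open>p \<ge> 1\<close>, except that
  \<open>P_1(0) = e\<close> (lemma \<open>weight_part_of_chart\<close>). This condition is linear in the
  coefficients of the Hamiltonian.

  If \<open>n \<ge> 3\<close> is the degree of \<open>G\<close> in \<open>X\<close>, the condition at \<open>a\<close> makes the coefficient of \<open>X^n\<close>,
  a polynomial in \<open>Y\<close> of degree at most \<open>6 - n\<close>, vanish to order at least \<open>n/2\<close> at \<open>a\<close>. Two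
  such points leave no room for \<open>n \<ge> 3\<close> (\<open>two_point_degree\<close>). So \<open>H\<close> has degree at most 2 in \<open>x\<close>
  and in \<open>w\<close>; what the conditions mean for such polynomials is spelled out in
  \<open>local_condition_quadratic\<close> and, for the charts \<open>(z, w)\<close> and \<open>(y, x - z)\<close>, in
  \<open>quadratic_at_infinity\<close>.

  The first two charts restrict the coefficient in \<open>H\<close> of every monomial \<open>z^k w^l\<close>, the three charts in \<open>z, w\<close>
  restrict the coefficient of every \<open>x^i y^j\<close>. Together with the degree bound this leaves few monomials
  containing \<open>x\<close>. The remaining chart mixes the two planes and
  expresses all others, except the constant term, through the parameters and the coefficient \<open>\<kappa>\<close> of \<open>x^2 y^2\<close>; its last
  equation is
  \<open>\<kappa> t (\<alpha>0 + \<alpha>1 + 2 \<alpha>2 + 2 \<alpha>3 + \<alpha>4 + \<alpha>5) = 1\<close>, whose right hand side comes from the moving point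
  \<open>y = -t\<close>. The normalization of the parameters gives \<open>\<kappa> = 1/t\<close>
  (\<open>coefficients_determined\<close>), and \<open>H\<close> is known up to an additive element of \<open>\<complex>(t)\<close>.
\<close>

section \<open>Polynomials as finite sums\<close>

lemma poly_poly_eqI:
  fixes p q :: "'a::field_char_0 poly poly"
  assumes "\<And>x s. x \<noteq> 0 \<Longrightarrow> poly (poly p [:x:]) s = poly (poly q [:x:]) s"
  shows "p = q"
proof (rule ccontr)
  assume "p \<noteq> q"
  hence "finite {r. poly (p - q) r = 0}" by (intro poly_roots_finite) simp
  moreover have "(\<lambda>x. [:x:]) ` (UNIV - {0}) \<subseteq> {r. poly (p - q) r = 0}"
  proof safe
    fix x :: 'a assume "x \<noteq> 0"
    hence "poly (poly p [:x:]) = poly (poly q [:x:])" using assms by blast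
    thus "poly (p - q) [:x:] = 0" by (simp add: poly_eq_poly_eq_iff)
  qed
  ultimately have "finite ((\<lambda>x::'a. [:x:]) ` (UNIV - {0}))" using finite_subset by blast
  moreover have "inj_on (\<lambda>x::'a. [:x:]) (UNIV - {0})" by (auto intro: inj_onI)
  ultimately have "finite (UNIV - {0} :: 'a set)" using finite_imageD by blast
  thus False using infinite_UNIV_char_0[where 'a='a] by simp
qed

lemma pderiv_sum: "pderiv (sum f A) = (\<Sum>i\<in>A. pderiv (f i))"
  by (induction A rule: infinite_finite_induct) (simp_all add: pderiv_add)

lemma smult_sum_right: "smult c (sum f A) = (\<Sum>i\<in>A. smult c (f i))"
  by (induction A rule: infinite_finite_induct) (simp_all add: smult_add_right)

lemma pcompose_power: "pcompose (p ^ n) q = pcompose p q ^ n"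
  for p :: "'a::idom poly"
  by (induction n) (simp_all add: pcompose_mult pcompose_1)

lemma poly_eq_sum:
  fixes p :: "'a::idom poly"
  assumes "degree p \<le> N"
  shows "poly p x = (\<Sum>i\<le>N. coeff p i * x ^ i)"
  by (subst poly_as_sum_of_monoms'[OF assms, symmetric]) (simp add: poly_sum poly_monom)

lemma poly_pderiv_eq_sum:
  fixes p :: "'a::idom poly"
  assumes "degree p \<le> N"
  shows "poly (pderiv p) x = (\<Sum>i\<le>N. coeff p i * (of_nat i * x ^ (i - 1)))"
  by (subst poly_as_sum_of_monoms'[OF assms, symmetric])
    (simp add: pderiv_sum pderiv_monom poly_sum poly_monom mult_ac)

section \<open>Regularity in a chart and weight parts\<close>

text \<open>\<open>F\<close> is a polynomial in the coordinates of the chart that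
  separates the curves through the point \<open>X = \<infinity>, Y = a\<close> along which \<open>X (Y - a)\<close> tends to \<open>-\<beta>\<close>.\<close>
definition in_chart :: "'a::field_char_0 \<Rightarrow> 'a \<Rightarrow> ('a \<Rightarrow> 'a \<Rightarrow> 'a) \<Rightarrow> bool" where
  "in_chart a \<beta> F \<longleftrightarrow> (\<exists>M q. \<forall>X Y. X \<noteq> 0 \<longrightarrow>
     F X Y = (\<Sum>m\<le>M. \<Sum>n\<le>M. q m n * (1 / X) ^ m * (- ((X * (Y - a) + \<beta>) * X)) ^ (n::nat)))"

text \<open>With weights \<open>1\<close> for \<open>X\<close> and \<open>-1\<close> for \<open>Y\<close>, the part of weight \<open>p\<close> of \<open>\<Sum> c n j X^n Y^j\<close> is \<open>X^p\<close> times a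
  polynomial in \<open>X Y\<close>. It is written here as a polynomial in \<open>s = X Y + \<beta>\<close>.\<close>
definition weight_part :: "nat \<Rightarrow> (nat \<Rightarrow> nat \<Rightarrow> 'a) \<Rightarrow> 'a \<Rightarrow> nat \<Rightarrow> 'a::field_char_0 poly" where
  "weight_part N c \<beta> p = (\<Sum>n\<le>N. \<Sum>j\<le>N. if n = p + j then smult (c n j) ([:- \<beta>, 1:] ^ j) else 0)"

text \<open>In the variables \<open>X\<close> and \<open>s\<close> the monomial \<open>X^n Y^j\<close> with \<open>n = p + j\<close> contributes
  \<open>p (s - \<beta>)^j - s j (s - \<beta>)^(j - 1)\<close> at \<open>X^(p + 1)\<close>. Modulo \<open>s^(p + 1)\<close> the coefficients of \<open>p P_p - s P_p'\<close> must
  agree with those of \<open>[p = 1] e\<close>, and its coefficient at \<open>s^m\<close> is \<open>p - m\<close> times that of \<open>P_p\<close>. The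
  factor vanishes only for \<open>m = p\<close>, so exactly the powers \<open>m < p\<close> are determined.\<close>
lemma weight_part_of_chart:
  fixes c :: "nat \<Rightarrow> nat \<Rightarrow> 'a::field_char_0"
  assumes chart: "in_chart 0 \<beta> (\<lambda>X Y. (\<Sum>n\<le>N. \<Sum>j\<le>N. c n j *
      (X^2 * (of_nat n * X ^ (n - 1)) * Y ^ j - (2 * X * Y + \<beta>) * X ^ n * (of_nat j * Y ^ (j - 1))))
      - e * X^2)"
    and p: "p \<ge> 1" and m: "m < p"
  shows "coeff (weight_part N c \<beta> p) m = (if p = 1 \<and> m = 0 then e else 0)"
proof -
  obtain M q where q: "\<And>X Y. X \<noteq> 0 \<Longrightarrow> (\<Sum>n\<le>N. \<Sum>j\<le>N. c n j *
      (X^2 * (of_nat n * X ^ (n - 1)) * Y ^ j - (2 * X * Y + \<beta>) * X ^ n * (of_nat j * Y ^ (j - 1))))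
      - e * X^2 = (\<Sum>m\<le>M. \<Sum>n\<le>M. q m n * (1 / X) ^ m * (- ((X * Y + \<beta>) * X)) ^ n)"
    using chart unfolding in_chart_def by auto
  (* Multiplication by X^K clears all negative powers of X on both sides. *)
  define K where "K = M + N"
  define v :: "'a poly" where "v = [:- \<beta>, 1:]"
  define u where "u n j = smult (of_nat n) (v ^ j) - ([:0, 1:] + v) * smult (of_nat j) (v ^ (j - 1))"
    for n j
  define L where "L = (\<Sum>n\<le>N. \<Sum>j\<le>N. monom (smult (c n j) (u n j)) (n + 1 + K - j)) - monom [:e:] (K + 2)"
  define R where "R = (\<Sum>a\<le>M. \<Sum>b\<le>M. monom (smult (q a b) (monom ((-1) ^ b) b)) (K + b - a))"
  have "L = R"
  proof (rule poly_poly_eqI)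
    fix X s :: 'a assume X: "X \<noteq> 0"
    define Y where "Y = (s - \<beta>) / X"
    have XY: "X * Y = s - \<beta>" using X by (simp add: Y_def)
    have l: "poly (poly (monom (smult (c n j) (u n j)) (n + 1 + K - j)) [:X:]) s
        = X ^ K * (c n j * (X^2 * (of_nat n * X ^ (n - 1)) * Y ^ j
            - (2 * X * Y + \<beta>) * X ^ n * (of_nat j * Y ^ (j - 1))))" if "j \<le> N" for n j
    proof -
      have a: "X ^ (n + 1 + K - j) * (s - \<beta>) ^ j = X ^ K * (X ^ (n + 1)) * Y ^ j"
      proof -
        have "X ^ (n + 1 + K - j) * (s - \<beta>) ^ j = X ^ (n + 1 + K - j) * X ^ j * Y ^ j"
          by (simp add: XY[symmetric] power_mult_distrib)
        also have "X ^ (n + 1 + K - j) * X ^ j = X ^ (n + 1 + K)"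
          using that by (simp add: K_def flip: power_add)
        finally show ?thesis by (simp add: power_add algebra_simps)
      qed
      have b: "X ^ (n + 1 + K - j) * (of_nat j * (s - \<beta>) ^ (j - 1)) = X ^ K * X ^ n * (of_nat j * Y ^ (j - 1))"
      proof (cases j)
        case (Suc i)
        have "X ^ (n + 1 + K - j) * (s - \<beta>) ^ i = X ^ (n + 1 + K - j) * X ^ i * Y ^ i"
          by (simp add: XY[symmetric] power_mult_distrib)
        also have "X ^ (n + 1 + K - j) * X ^ i = X ^ (n + K)"
          using that Suc by (simp add: K_def flip: power_add)
        finally show ?thesis using Suc by (simp add: power_add algebra_simps)
      qed simp
      have c: "of_nat n * X ^ (n + 1) = X^2 * (of_nat n * X ^ (n - 1))"
        by (cases n) (simp_all add: power2_eq_square)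
      have "poly (poly (monom (smult (c n j) (u n j)) (n + 1 + K - j)) [:X:]) s =
          c n j * (of_nat n * (X ^ (n + 1 + K - j) * (s - \<beta>) ^ j)
            - (2 * s - \<beta>) * (X ^ (n + 1 + K - j) * (of_nat j * (s - \<beta>) ^ (j - 1))))"
        by (simp add: u_def v_def poly_monom poly_const_pow algebra_simps)
      also have "\<dots> = c n j * (X ^ K * (of_nat n * X ^ (n + 1)) * Y ^ j
            - (2 * (X * Y) + \<beta>) * (X ^ K * X ^ n * (of_nat j * Y ^ (j - 1))))"
        unfolding a b by (simp add: XY algebra_simps)
      finally show ?thesis unfolding c by (simp add: algebra_simps)
    qed
    have r: "poly (poly (monom (smult (q a b) (monom ((-1) ^ b) b)) (K + b - a)) [:X:]) s
        = X ^ K * (q a b * (1 / X) ^ a * (- ((X * Y + \<beta>) * X)) ^ b)" if "a \<le> M" for a b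
    proof -
      have "X ^ (K + b - a) * X ^ a = X ^ K * X ^ b"
        using that by (simp add: K_def flip: power_add)
      hence "X ^ (K + b - a) = X ^ K * X ^ b * (1 / X) ^ a"
        using X by (simp add: field_simps power_one_over)
      moreover have "(- ((X * Y + \<beta>) * X)) ^ b = (-1) ^ b * s ^ b * X ^ b"
        by (simp add: XY power_minus[of "s * X"] power_mult_distrib)
      ultimately show ?thesis by (simp add: poly_monom poly_const_pow algebra_simps)
    qed
    have "poly (poly L [:X:]) s = X ^ K * ((\<Sum>n\<le>N. \<Sum>j\<le>N. c n j *
      (X^2 * (of_nat n * X ^ (n - 1)) * Y ^ j - (2 * X * Y + \<beta>) * X ^ n * (of_nat j * Y ^ (j - 1))))
      - e * X^2)"
    proof -
      have "poly (poly L [:X:]) s = (\<Sum>n\<le>N. \<Sum>j\<le>N.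
          poly (poly (monom (smult (c n j) (u n j)) (n + 1 + K - j)) [:X:]) s)
          - poly (poly (monom [:e:] (K + 2)) [:X:]) s"
        unfolding L_def poly_diff poly_sum ..
      also have "poly (poly (monom [:e:] (K + 2)) [:X:]) s = X ^ K * (e * X^2)"
        by (simp add: poly_monom poly_const_pow power_add algebra_simps power2_eq_square)
      also have "(\<Sum>n\<le>N. \<Sum>j\<le>N.
          poly (poly (monom (smult (c n j) (u n j)) (n + 1 + K - j)) [:X:]) s)
          = X ^ K * (\<Sum>n\<le>N. \<Sum>j\<le>N. c n j * (X^2 * (of_nat n * X ^ (n - 1)) * Y ^ j
              - (2 * X * Y + \<beta>) * X ^ n * (of_nat j * Y ^ (j - 1))))"
        unfolding sum_distrib_left by (intro sum.cong refl l) simp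
      finally show ?thesis by (simp only: right_diff_distrib[of "X ^ K" "sum _ _"])
    qed
    also have "\<dots> = X ^ K * (\<Sum>m\<le>M. \<Sum>n\<le>M. q m n * (1 / X) ^ m * (- ((X * Y + \<beta>) * X)) ^ n)"
      using q[OF X] by simp
    also have "\<dots> = poly (poly R [:X:]) s"
      unfolding R_def poly_sum sum_distrib_left by (intro sum.cong refl r[symmetric]) simp
    finally show "poly (poly L [:X:]) s = poly (poly R [:X:]) s" .
  qed
  hence LR: "coeff (coeff L (K + p + 1)) m = coeff (coeff R (K + p + 1)) m" by simp
  have "coeff (coeff R (K + p + 1)) m = 0"
    unfolding R_def using m by (auto simp: coeff_sum K_def intro!: sum.neutral)
  moreover have "coeff L (K + p + 1) = smult (of_nat p) (weight_part N c \<beta> p)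
      - [:0, 1:] * pderiv (weight_part N c \<beta> p) - (if p = 1 then [:e:] else 0)"
  proof -
    have t: "coeff (monom (smult (c n j) (u n j)) (n + 1 + K - j)) (K + p + 1)
       = smult (of_nat p) (if n = p + j then smult (c n j) ([:- \<beta>, 1:] ^ j) else 0)
         - [:0, 1:] * pderiv (if n = p + j then smult (c n j) ([:- \<beta>, 1:] ^ j) else 0)"
      if "j \<le> N" for n j
    proof (cases "n = p + j")
      case True
      have dv: "pderiv (v ^ j) = smult (of_nat j) (v ^ (j - 1))"
        by (cases j) (simp_all add: v_def pderiv_power_Suc pderiv_pCons del: power_Suc)
      have "v * smult (of_nat j) (v ^ (j - 1)) = smult (of_nat j) (v ^ j)"
        by (cases j) simp_all
      hence "u n j = smult (of_nat p) (v ^ j) + smult (of_nat j) (v ^ j)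
          - ([:0, 1:] * pderiv (v ^ j) + smult (of_nat j) (v ^ j))"
        unfolding u_def True dv distrib_right of_nat_add smult_add_left by (simp only:)
      hence "u n j = smult (of_nat p) (v ^ j) - [:0, 1:] * pderiv (v ^ j)"
        by (simp only: add_diff_cancel_right)
      moreover have "coeff (monom (smult (c n j) (u n j)) (n + 1 + K - j)) (K + p + 1) = smult (c n j) (u n j)"
        using True by (simp add: algebra_simps)
      ultimately show ?thesis using True
        by (simp add: v_def pderiv_smult smult_diff_right mult.commute)
    next
      case False
      thus ?thesis using that by (auto simp: K_def)
    qed
    show ?thesis
      unfolding L_def weight_part_def pderiv_sum smult_sum_right sum_distrib_left coeff_diff coeff_sum
        sum_subtractf[symmetric]
      by (intro arg_cong2[of _ _ _ _ minus] sum.cong refl t) (auto simp: K_def)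
  qed
  ultimately have *: "coeff (smult (of_nat p) (weight_part N c \<beta> p) - [:0, 1:] * pderiv (weight_part N c \<beta> p)
      - (if p = 1 then [:e:] else 0)) m = 0"
    using LR by (simp only:)
  have "(of_nat p - of_nat m) * coeff (weight_part N c \<beta> p) m = (if p = 1 \<and> m = 0 then e else 0)"
  proof (cases m)
    case 0
    with * show ?thesis by (cases "p = 1") simp_all
  next
    case (Suc i)
    with * have "of_nat p * coeff (weight_part N c \<beta> p) m = (of_nat i + 1) * coeff (weight_part N c \<beta> p) m"
      by (cases "p = 1") (simp_all add: coeff_pderiv add.commute)
    moreover have "of_nat m = (of_nat i + 1 :: 'a)" by (simp add: Suc)
    ultimately show ?thesis using Suc by (simp only: left_diff_distrib) simp
  qed
  moreover have "of_nat p - of_nat m \<noteq> (0::'a)" using m by simp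
  ultimately show ?thesis using p m by (auto simp: field_simps split: if_splits)
qed

lemma coeff_weight_sum:
  "coeff (\<Sum>n\<le>N. \<Sum>j\<le>N. if n = p + j then monom (c n j) j else 0) i
    = (if p + i \<le> N then c (p + i) i else (0::'a::field_char_0))"
proof -
  have "coeff (\<Sum>n\<le>N. \<Sum>j\<le>N. if n = p + j then monom (c n j) j else 0) i
      = (\<Sum>n\<le>N. \<Sum>j\<le>N. if j = i then (if n = p + j then c n j else 0) else 0)"
    unfolding coeff_sum by (intro sum.cong refl) auto
  also have "\<dots> = (\<Sum>n\<le>N. if n = p + i then if i \<le> N then c n i else 0 else 0)"
    by (intro sum.cong refl) (auto simp: sum.delta)
  also have "\<dots> = (if p + i \<le> N then c (p + i) i else 0)" by (auto simp: sum.delta)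
  finally show ?thesis .
qed

lemma weight_part_eq_pcompose:
  "weight_part N c \<beta> p = pcompose (\<Sum>n\<le>N. \<Sum>j\<le>N. if n = p + j then monom (c n j) j else 0) [:- \<beta>, 1:]"
  unfolding weight_part_def pcompose_sum
  by (intro sum.cong refl) (simp add: monom_altdef pcompose_smult pcompose_power pcompose_pCons)

text \<open>A polynomial of degree less than \<open>p\<close> that is divisible by \<open>s^p\<close> is zero. The hypothesis \<open>high\<close>
  expresses the bound on the degree.\<close>
lemma weight_part_vanishes:
  fixes c :: "nat \<Rightarrow> nat \<Rightarrow> 'a::field_char_0"
  assumes low: "\<And>m. m < p \<Longrightarrow> coeff (weight_part N c \<beta> p) m = 0"
    and high: "\<And>j. j \<ge> p \<Longrightarrow> p + j \<le> N \<Longrightarrow> c (p + j) j = 0"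
    and j: "p + j \<le> N"
  shows "c (p + j) j = 0"
proof -
  define R where "R = (\<Sum>n\<le>N. \<Sum>j\<le>N. if n = p + j then monom (c n j) j else 0)"
  have R: "coeff R i = (if p + i \<le> N then c (p + i) i else 0)" for i
    unfolding R_def by (rule coeff_weight_sum)
  have D: "weight_part N c \<beta> p = pcompose R [:- \<beta>, 1:]" unfolding R_def by (rule weight_part_eq_pcompose)
  have "coeff R i = 0" if "i \<ge> p" for i using high[of i] that by (simp add: R)
  hence "R = 0 \<or> degree R < p" by (metis leading_coeff_0_iff not_le)
  moreover have "degree (weight_part N c \<beta> p) = degree R" unfolding D by (simp add: degree_pcompose)
  ultimately have "weight_part N c \<beta> p = 0"
    using low[of "degree (weight_part N c \<beta> p)"] D by (metis leading_coeff_0_iff pcompose_0)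
  hence "R = 0" unfolding D by (rule pcompose_eq_0) simp
  thus ?thesis using R[of j] j by simp
qed

section \<open>Two points with finite ordinate\<close>

text \<open>The Hamiltonian is \<open>\<Sum> X^n f n(Y)\<close>. The function required to be regular is the derivative of
  \<open>-(X (Y - a) + \<beta>) X\<close> along its flow, when \<open>dX/dt = G_Y\<close>, \<open>dY/dt = -G_X\<close> and the point \<open>a\<close>
  moves with velocity \<open>-e\<close>.\<close>

definition local_condition ::
    "nat \<Rightarrow> (nat \<Rightarrow> 'a::field_char_0 poly) \<Rightarrow> 'a \<Rightarrow> 'a \<Rightarrow> 'a \<Rightarrow> bool" where
  "local_condition N f a \<beta> e \<longleftrightarrow> in_chart a \<beta> (\<lambda>X Y. (\<Sum>n\<le>N.
      X^2 * (of_nat n * X ^ (n - 1)) * poly (f n) Y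
      - (2 * X * (Y - a) + \<beta>) * X ^ n * poly (pderiv (f n)) Y) - e * X^2)"

lemma local_condition_weight_part:
  assumes f: "local_condition N f a \<beta> e" and N: "\<And>n. degree (f n) \<le> N"
    and p: "p \<ge> 1" "m < p"
  shows "coeff (weight_part N (\<lambda>n j. coeff (pcompose (f n) [:a, 1:]) j) \<beta> p) m
    = (if p = 1 \<and> m = 0 then e else 0)"
proof -
  define g where "g n = pcompose (f n) [:a, 1:]" for n
  have dg: "degree (g n) \<le> N" for n using N[of n] by (simp add: g_def degree_pcompose)
  have g: "poly (f n) (a + Y) = (\<Sum>j\<le>N. coeff (g n) j * Y ^ j)" for n Y
    by (subst poly_eq_sum[OF dg, symmetric]) (simp add: g_def poly_pcompose)
  have g': "poly (pderiv (f n)) (a + Y) = (\<Sum>j\<le>N. coeff (g n) j * (of_nat j * Y ^ (j - 1)))" for n Y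
    by (subst poly_pderiv_eq_sum[OF dg, symmetric])
      (simp add: g_def poly_pcompose pderiv_pcompose pderiv_pCons)
  obtain M q where q: "\<And>X Y. X \<noteq> 0 \<Longrightarrow> (\<Sum>n\<le>N.
      X^2 * (of_nat n * X ^ (n - 1)) * poly (f n) Y
      - (2 * X * (Y - a) + \<beta>) * X ^ n * poly (pderiv (f n)) Y) - e * X^2
      = (\<Sum>m\<le>M. \<Sum>n\<le>M. q m n * (1 / X) ^ m * (- ((X * (Y - a) + \<beta>) * X)) ^ n)"
    using f unfolding local_condition_def in_chart_def by blast
  have "in_chart 0 \<beta> (\<lambda>X Y. (\<Sum>n\<le>N. \<Sum>j\<le>N. coeff (g n) j *
      (X^2 * (of_nat n * X ^ (n - 1)) * Y ^ j - (2 * X * Y + \<beta>) * X ^ n * (of_nat j * Y ^ (j - 1))))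
      - e * X^2)"
    unfolding in_chart_def
  proof (intro exI allI impI)
    fix X Y :: 'a assume X: "X \<noteq> 0"
    show "(\<Sum>n\<le>N. \<Sum>j\<le>N. coeff (g n) j *
      (X^2 * (of_nat n * X ^ (n - 1)) * Y ^ j - (2 * X * Y + \<beta>) * X ^ n * (of_nat j * Y ^ (j - 1))))
      - e * X^2 = (\<Sum>m\<le>M. \<Sum>n\<le>M. q m n * (1 / X) ^ m * (- ((X * (Y - 0) + \<beta>) * X)) ^ n)"
      using q[OF X, of "a + Y"] unfolding g g'
      by (simp add: sum_distrib_left sum_subtractf right_diff_distrib mult_ac)
  qed
  from weight_part_of_chart[OF this p] show ?thesis by (simp add: g_def)
qed

text \<open>The top coefficient contributes \<open>X^n (Y - a)^j\<close> to weight \<open>n - j\<close>. For \<open>2 * j < n\<close> this weight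
  exceeds \<open>n/2\<close>, so that its weight part has degree less than its weight and must vanish.\<close>
lemma local_condition_top:
  assumes f: "local_condition N f a \<beta> e" and N: "\<And>n. degree (f n) \<le> N"
    and n: "3 \<le> n" "n \<le> N" and above: "\<And>i. i > n \<Longrightarrow> f i = 0" and j: "2 * j < n"
  shows "coeff (pcompose (f n) [:a, 1:]) j = 0"
proof -
  define p where "p = n - j"
  have p: "p \<ge> 2" "p + j = n" "n < 2 * p" using j n unfolding p_def by linarith+
  have "coeff (pcompose (f (p + j)) [:a, 1:]) j = 0"
  proof (rule weight_part_vanishes[where N = N and \<beta> = \<beta> and c = "\<lambda>n j. coeff (pcompose (f n) [:a, 1:]) j"])
    show "coeff (weight_part N (\<lambda>n j. coeff (pcompose (f n) [:a, 1:]) j) \<beta> p) m = 0" if "m < p" for m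
      using local_condition_weight_part[OF f N, of p m] that p by simp
    show "coeff (pcompose (f (p + i)) [:a, 1:]) i = 0" if "i \<ge> p" for i
      using above[of "p + i"] that p by simp
  qed (use p n in auto)
  thus ?thesis using p by simp
qed

text \<open>The two equations are the conditions in weights 2 and 1. The weight part of weight 1 is
  \<open>f 1(a) + (s - \<beta>) (f 2)'(a)\<close>, whose value at \<open>s = 0\<close> is \<open>e\<close>.\<close>
lemma local_condition_quadratic:
  assumes f: "local_condition N f a \<beta> e" and N: "\<And>n. degree (f n) \<le> N" "N \<ge> 2"
    and above: "\<And>i. i > 2 \<Longrightarrow> f i = 0"
  shows "poly (f 2) a = 0" "poly (f 1) a = \<beta> * poly (pderiv (f 2)) a + e"
proof -
  define c where "c n j = coeff (pcompose (f n) [:a, 1:]) j" for n j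
  have c0: "c n j = 0" if "n > 2" for n j using above[OF that] by (simp add: c_def)
  have d: "coeff (weight_part N c \<beta> p) m = (if p = 1 \<and> m = 0 then e else 0)" if "p \<ge> 1" "m < p" for p m
    using local_condition_weight_part[OF f N(1) that] unfolding c_def .
  have "c (2 + 0) 0 = 0"
    by (rule weight_part_vanishes[where N = N and \<beta> = \<beta>]) (use d[of 2] c0 N in auto)
  thus "poly (f 2) a = 0" by (simp add: c_def)
  define R where "R = (\<Sum>n\<le>N. \<Sum>j\<le>N. if n = 1 + j then monom (c n j) j else 0)"
  have R: "coeff R i = (if i = 0 then c 1 0 else if i = 1 then c 2 1 else 0)" for i
    unfolding R_def coeff_weight_sum using N c0 by (auto simp: numeral_2_eq_2)
  have "R = [:c 1 0, c 2 1:]" by (rule poly_eqI) (auto simp: R coeff_pCons split: nat.split)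
  hence "coeff (weight_part N c \<beta> 1) 0 = c 1 0 - \<beta> * c 2 1"
    unfolding weight_part_eq_pcompose R_def[symmetric] by (simp add: pcompose_pCons)
  hence "c 1 0 = \<beta> * c 2 1 + e" using d[of 1 0] by (simp add: algebra_simps)
  moreover have "coeff (pderiv (pcompose (f 2) [:a, 1:])) 0 = c 2 1"
    by (simp add: coeff_pderiv c_def)
  hence "c 2 1 = poly (pderiv (f 2)) a"
    by (simp add: pderiv_pcompose pderiv_pCons)
  ultimately show "poly (f 1) a = \<beta> * poly (pderiv (f 2)) a + e" by (simp add: c_def)
qed

lemma vanishes_at_two_points:
  fixes f :: "'a::field_char_0 poly"
  assumes "a \<noteq> b" and d: "degree f < 2 * r"
    and za: "\<And>j. j < r \<Longrightarrow> coeff (pcompose f [:a, 1:]) j = 0"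
    and zb: "\<And>j. j < r \<Longrightarrow> coeff (pcompose f [:b, 1:]) j = 0"
  shows "f = 0"
proof (rule ccontr)
  assume f: "f \<noteq> 0"
  have dvd: "[:- c, 1:] ^ r dvd f" if "\<And>j. j < r \<Longrightarrow> coeff (pcompose f [:c, 1:]) j = 0" for c
  proof -
    have "monom 1 r dvd pcompose f [:c, 1:]" using that by (simp add: monom_1_dvd_iff')
    then obtain g where g: "pcompose f [:c, 1:] = monom 1 r * g" by (rule dvdE)
    have "f = pcompose (pcompose f [:c, 1:]) [:- c, 1:]"
      by (subst poly_eq_poly_eq_iff[symmetric]) (simp add: poly_pcompose fun_eq_iff)
    also have "\<dots> = [:- c, 1:] ^ r * pcompose g [:- c, 1:]"
      unfolding g by (simp add: pcompose_mult monom_altdef pcompose_power pcompose_pCons)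
    finally show ?thesis by (rule dvdI)
  qed
  obtain g where g: "f = [:- a, 1:] ^ r * g" using dvd[OF za] by (rule dvdE)
  have "r \<le> order b f" using dvd[OF zb] f by (simp add: order_divides)
  also have "\<dots> = order b ([:- a, 1:] ^ r) + order b g"
    using f unfolding g by (rule order_mult)
  also have "order b ([:- a, 1:] ^ r) = 0"
    using assms(1) by (intro order_0I) (simp add: poly_power)
  also have "order b g \<le> degree g" using f g by (intro order_degree) auto
  finally have "r \<le> degree g" by simp
  moreover have "degree f = r + degree g"
    using f unfolding g by (subst degree_mult_eq) (auto simp: degree_power_eq)
  ultimately show False using d by simp
qed

text \<open>Descending from \<open>n = 6\<close>: the top coefficient has zeros of order at least \<open>n/2\<close>, rounded up, at
  both points, and degree at most \<open>6 - n\<close>. For \<open>n \<ge> 3\<close> these are too many zeros.\<close>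
lemma two_point_degree:
  assumes ab: "a \<noteq> b" and d: "\<And>n. n \<le> 6 \<Longrightarrow> degree (f n) \<le> 6 - n"
    and above: "\<And>n. n > 6 \<Longrightarrow> f n = 0"
    and fa: "local_condition 6 f a \<beta> e" and fb: "local_condition 6 f b \<gamma> e'"
    and n: "n \<ge> 3"
  shows "f n = 0"
proof -
  have d6: "degree (f n) \<le> 6" for n
    using d[of n] above[of n] by (cases "n \<le> 6") (auto intro: order.trans)
  have step: "f k = 0" if k: "3 \<le> k" "k \<le> 6" and abv: "\<And>i. i > k \<Longrightarrow> f i = 0" for k
  proof (rule vanishes_at_two_points[OF ab, where r = "(k + 1) div 2"])
    have "k = 3 \<or> k = 4 \<or> k = 5 \<or> k = 6" using k by linarith
    thus "degree (f k) < 2 * ((k + 1) div 2)" using d[OF k(2)] by auto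
    show "coeff (pcompose (f k) [:a, 1:]) j = 0" if "j < (k + 1) div 2" for j
      by (rule local_condition_top[OF fa d6 k abv]) (use that in auto)
    show "coeff (pcompose (f k) [:b, 1:]) j = 0" if "j < (k + 1) div 2" for j
      by (rule local_condition_top[OF fb d6 k abv]) (use that in auto)
  qed
  have 6: "f i = 0" if "i > 5" for i using that above step[of 6] by (cases "i = 6") auto
  have 5: "f i = 0" if "i > 4" for i using that 6 step[of 5] by (cases "i = 5") auto
  have 4: "f i = 0" if "i > 3" for i using that 5 step[of 4] by (cases "i = 4") auto
  show ?thesis using n 4 step[of 3] by (cases "n = 3") auto
qed

section \<open>A chart for Hamiltonians quadratic in the ordinate\<close>

text \<open>For \<open>G = g0(X) + g1(X) Y + g2(X) Y^2\<close> all weight parts have degree at most 2. Hence they vanish in weights above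
  2; in weight 2 the part is a multiple of \<open>s^2 = (X Y + \<beta>)^2\<close>, and in weight 1 a
  multiple of \<open>s\<close>.\<close>
lemma quadratic_at_infinity:
  fixes g0 g1 g2 :: "'a::field_char_0 poly"
  assumes chart: "in_chart 0 \<beta> (\<lambda>X Y. X^2 * (poly (pderiv g0) X + poly (pderiv g1) X * Y + poly (pderiv g2) X * Y^2)
     - (2 * X * Y + \<beta>) * (poly g1 X + 2 * poly g2 X * Y))"
  shows "n \<ge> 3 \<Longrightarrow> coeff g0 n = 0" "n \<ge> 4 \<Longrightarrow> coeff g1 n = 0" "n \<ge> 5 \<Longrightarrow> coeff g2 n = 0"
    "coeff g1 3 = 2 * \<beta> * coeff g2 4" "coeff g0 2 = \<beta>^2 * coeff g2 4"
    "coeff g0 1 = \<beta> * coeff g1 2 - \<beta>^2 * coeff g2 3"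
proof -
  define c where "c n j = (if j = 0 then coeff g0 n else if j = 1 then coeff g1 n
     else if j = 2 then coeff g2 n else 0)" for n j :: nat
  define D where "D = max (degree g0) (max (degree g1) (degree g2)) + 2"
  have D: "degree g0 \<le> D" "degree g1 \<le> D" "degree g2 \<le> D" "D \<ge> 2" by (auto simp: D_def)
  have key: "coeff (weight_part N c \<beta> p) m = 0" if p: "p \<ge> 1" "m < p" and N: "N \<ge> D" for N p m
  proof -
    have e: "(\<Sum>n\<le>N. \<Sum>j\<le>N. c n j *
      (X^2 * (of_nat n * X ^ (n - 1)) * Y ^ j - (2 * X * Y + \<beta>) * X ^ n * (of_nat j * Y ^ (j - 1))))
      = X^2 * (poly (pderiv g0) X + poly (pderiv g1) X * Y + poly (pderiv g2) X * Y^2)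
     - (2 * X * Y + \<beta>) * (poly g1 X + 2 * poly g2 X * Y)" for X Y
    proof -
      have s: "(\<Sum>j\<le>N. c n j * F j) = coeff g0 n * F 0 + coeff g1 n * F 1 + coeff g2 n * F 2"
        for n and F :: "nat \<Rightarrow> 'a"
      proof -
        have "(\<Sum>j\<le>N. c n j * F j) = (\<Sum>j\<le>2. c n j * F j)"
          using N D by (intro sum.mono_neutral_right) (auto simp: c_def)
        thus ?thesis by (simp add: c_def numeral_2_eq_2)
      qed
      have d: "degree g0 \<le> N" "degree g1 \<le> N" "degree g2 \<le> N" using D N by auto
      show ?thesis
        unfolding s poly_eq_sum[OF d(2)] poly_eq_sum[OF d(3)] poly_pderiv_eq_sum[OF d(1)]
          poly_pderiv_eq_sum[OF d(2)] poly_pderiv_eq_sum[OF d(3)]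
        by (simp add: sum_distrib_left sum_distrib_right sum.distrib[symmetric] sum_subtractf[symmetric])
          (intro sum.cong refl, simp add: algebra_simps)
    qed
    have "coeff (weight_part N c \<beta> p) m = (if p = 1 \<and> m = 0 then 0 else 0)"
      by (rule weight_part_of_chart[OF _ p]) (use chart e in simp)
    thus ?thesis by simp
  qed
  have high: "c (p + j) j = 0" if "p \<ge> 3" for p j
  proof (rule weight_part_vanishes[where N = "D + p + j" and \<beta> = \<beta>])
    show "coeff (weight_part (D + p + j) c \<beta> p) m = 0" if "m < p" for m
      using key[of p m "D + p + j"] that \<open>p \<ge> 3\<close> by simp
    show "c (p + j) j = 0" if "j \<ge> p" for j using that \<open>p \<ge> 3\<close> by (simp add: c_def)
  qed simp
  show "n \<ge> 3 \<Longrightarrow> coeff g0 n = 0" using high[of n 0] by (simp add: c_def)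
  show "n \<ge> 4 \<Longrightarrow> coeff g1 n = 0" using high[of "n - 1" 1] by (simp add: c_def)
  show "n \<ge> 5 \<Longrightarrow> coeff g2 n = 0" using high[of "n - 2" 2] by (simp add: c_def del: add_2_eq_Suc')
  have expl: "weight_part (D + p) c \<beta> p
     = pcompose [:coeff g0 p, coeff g1 (p + 1), coeff g2 (p + 2):] [:- \<beta>, 1:]" for p
  proof -
    have "(\<Sum>n\<le>D + p. \<Sum>j\<le>D + p. if n = p + j then monom (c n j) j else 0)
      = [:coeff g0 p, coeff g1 (p + 1), coeff g2 (p + 2):]"
      using D(4) unfolding poly_eq_iff coeff_weight_sum
      by (auto simp: c_def coeff_pCons numeral_2_eq_2 split: nat.split)
    thus ?thesis unfolding weight_part_eq_pcompose by simp
  qed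
  have m1: "coeff g0 1 - \<beta> * (coeff g1 2 - \<beta> * coeff g2 3) = 0"
    using key[of 1 0 "D + 1"] unfolding expl by (simp add: pcompose_pCons numeral_2_eq_2 numeral_3_eq_3)
  have m20: "coeff g0 2 - \<beta> * (coeff g1 3 - \<beta> * coeff g2 4) = 0"
    using key[of 2 0 "D + 2"] unfolding expl by (simp add: pcompose_pCons eval_nat_numeral)
  have m21: "coeff g1 3 - 2 * \<beta> * coeff g2 4 = 0"
    using key[of 2 1 "D + 2"] unfolding expl by (simp add: pcompose_pCons eval_nat_numeral algebra_simps)
  show "coeff g1 3 = 2 * \<beta> * coeff g2 4" using m21 by simp
  show "coeff g0 1 = \<beta> * coeff g1 2 - \<beta>^2 * coeff g2 3"
    using m1 by (simp add: algebra_simps power2_eq_square)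
  show "coeff g0 2 = \<beta>^2 * coeff g2 4"
    using m20 m21 by (simp add: algebra_simps power2_eq_square)
qed

section \<open>Evaluation at points\<close>

instance fract :: ("{idom, ring_char_0}") ring_char_0
  by standard (auto intro!: injI simp: of_nat_fract eq_fract)

instance fract :: ("{idom, ring_char_0}") field_char_0 ..

definition ev :: "'a::comm_ring_1 poly poly poly poly \<Rightarrow> 'a \<Rightarrow> 'a \<Rightarrow> 'a \<Rightarrow> 'a \<Rightarrow> 'a" where
  "ev p x y z w = poly (poly (poly (poly p [:[:[:w:]:]:]) [:[:z:]:]) [:y:]) x"

lemma ev_simps [simp]:
  "ev 0 x y z w = 0" "ev 1 x y z w = 1" "ev (p + q) x y z w = ev p x y z w + ev q x y z w"
  "ev (p - q) x y z w = ev p x y z w - ev q x y z w" "ev (- p) x y z w = - ev p x y z w"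
  "ev (p * q) x y z w = ev p x y z w * ev q x y z w"
  by (simp_all add: ev_def)

text \<open>As \<open>\<complex>(t)\<close> is infinite, identities between rational functions over it can be tested at the
  points of \<open>\<complex>(t)^4\<close> where the denominators do not vanish. In this way the substitution of one
  rational function into another becomes the evaluation at a point.\<close>
definition has_value :: "ct \<Rightarrow> ct \<Rightarrow> ct \<Rightarrow> ct \<Rightarrow> rat4 \<Rightarrow> ct \<Rightarrow> bool" where
  "has_value x y z w q v \<longleftrightarrow> (\<exists>a b. ev b x y z w \<noteq> 0 \<and> q = to_fract a / to_fract b \<and>
     v = ev a x y z w / ev b x y z w)"

lemma has_value_unique:
  assumes "has_value x y z w q u" "has_value x y z w q v"
  shows "u = v"
proof -
  obtain a b where ab: "ev b x y z w \<noteq> 0" "q = to_fract a / to_fract b" "u = ev a x y z w / ev b x y z w"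
    using assms(1) unfolding has_value_def by blast
  obtain c d where cd: "ev d x y z w \<noteq> 0" "q = to_fract c / to_fract d" "v = ev c x y z w / ev d x y z w"
    using assms(2) unfolding has_value_def by blast
  have "b \<noteq> 0" "d \<noteq> 0" using ab(1) cd(1) by auto
  hence "to_fract (a * d) = to_fract (c * b)"
    using ab(2) cd(2) by (simp add: frac_eq_eq)
  hence "a * d = c * b" by (simp only: to_fract_eq_iff)
  hence "ev (a * d) x y z w = ev (c * b) x y z w" by simp
  thus ?thesis using ab(1,3) cd(1,3) by (simp add: frac_eq_eq)
qed

lemma has_value_to_fract: "has_value x y z w (to_fract p) (ev p x y z w)"
  unfolding has_value_def by (rule exI[of _ p], rule exI[of _ 1]) simp

lemma has_value_add:
  assumes "has_value x y z w q u" "has_value x y z w r v"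
  shows "has_value x y z w (q + r) (u + v)"
proof -
  obtain a b where ab: "ev b x y z w \<noteq> 0" "q = to_fract a / to_fract b" "u = ev a x y z w / ev b x y z w"
    using assms(1) unfolding has_value_def by blast
  obtain c d where cd: "ev d x y z w \<noteq> 0" "r = to_fract c / to_fract d" "v = ev c x y z w / ev d x y z w"
    using assms(2) unfolding has_value_def by blast
  have "b \<noteq> 0" "d \<noteq> 0" using ab(1) cd(1) by auto
  hence "q + r = to_fract (a * d + c * b) / to_fract (b * d)"
    using ab(2) cd(2) by (simp add: add_frac_eq)
  moreover have "u + v = ev (a * d + c * b) x y z w / ev (b * d) x y z w"
    using ab cd by (simp add: add_frac_eq)
  moreover have "ev (b * d) x y z w \<noteq> 0" using ab cd by simp
  ultimately show ?thesis unfolding has_value_def by blast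
qed

lemma has_value_mult:
  assumes "has_value x y z w q u" "has_value x y z w r v"
  shows "has_value x y z w (q * r) (u * v)"
proof -
  obtain a b where ab: "ev b x y z w \<noteq> 0" "q = to_fract a / to_fract b" "u = ev a x y z w / ev b x y z w"
    using assms(1) unfolding has_value_def by blast
  obtain c d where cd: "ev d x y z w \<noteq> 0" "r = to_fract c / to_fract d" "v = ev c x y z w / ev d x y z w"
    using assms(2) unfolding has_value_def by blast
  have "q * r = to_fract (a * c) / to_fract (b * d)" "u * v = ev (a * c) x y z w / ev (b * d) x y z w"
    "ev (b * d) x y z w \<noteq> 0"
    using ab cd by simp_all
  thus ?thesis unfolding has_value_def by blast
qed

lemma has_value_inverse:
  assumes "has_value x y z w q u" "u \<noteq> 0"
  shows "has_value x y z w (1 / q) (1 / u)"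
proof -
  obtain a b where ab: "ev b x y z w \<noteq> 0" "q = to_fract a / to_fract b" "u = ev a x y z w / ev b x y z w"
    using assms(1) unfolding has_value_def by blast
  have "1 / q = to_fract b / to_fract a" "1 / u = ev b x y z w / ev a x y z w" "ev a x y z w \<noteq> 0"
    using ab assms(2) by auto
  thus ?thesis unfolding has_value_def by blast
qed

lemma ev_const: "ev [:[:[:[:c:]:]:]:] x y z w = c"
  by (simp add: ev_def)

lemma has_value_const4: "has_value x y z w (const4 c) c"
  using has_value_to_fract[of x y z w "[:[:[:[:c:]:]:]:]"] by (simp add: const4_def ev_const)

lemma const4_hom: "const4 0 = 0" "const4 1 = 1" "const4 (- c) = - const4 c"
  by (simp_all add: const4_def flip: one_pCons to_fract_uminus)

lemma has_value_numeral: "has_value x y z w (numeral n) (numeral n)"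
proof -
  have "to_fract (numeral n :: pol4) = numeral n"
  proof -
    have "to_fract (of_nat m :: pol4) = of_nat m" for m by (induction m) simp_all
    thus ?thesis by (metis of_nat_numeral)
  qed
  moreover have "ev (numeral n :: pol4) x y z w = numeral n" by (simp add: ev_def)
  ultimately show ?thesis using has_value_to_fract[of x y z w "numeral n"] by simp
qed

lemma has_value_minus: "has_value x y z w q u \<Longrightarrow> has_value x y z w (- q) (- u)"
  using has_value_mult[OF has_value_const4[of _ _ _ _ "- 1"]] by (fastforce simp: const4_hom)

lemma has_value_diff:
  "has_value x y z w q u \<Longrightarrow> has_value x y z w r v \<Longrightarrow> has_value x y z w (q - r) (u - v)"
  using has_value_add[OF _ has_value_minus] by fastforce

lemma has_value_divide:
  "has_value x y z w q u \<Longrightarrow> has_value x y z w r v \<Longrightarrow> v \<noteq> 0 \<Longrightarrow> has_value x y z w (q / r) (u / v)"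
  using has_value_mult[OF _ has_value_inverse] by fastforce

lemma has_value_power: "has_value x y z w q u \<Longrightarrow> has_value x y z w (q ^ n) (u ^ n)"
  by (induction n) (use has_value_const4[of x y z w 1] in \<open>simp_all add: const4_hom has_value_mult\<close>)

lemma has_value_vars:
  "has_value x y z w vx x" "has_value x y z w vy y" "has_value x y z w vz z" "has_value x y z w vw w"
  "has_value x y z w vt (to_fract [:0, 1:])" "has_value x y z w (cc a) (to_fract [:a:])"
proof -
  have e: "ev [:[:[:[:0, 1:]:]:]:] x y z w = x" "ev [:[:[:0, 1:]:]:] x y z w = y"
    "ev [:[:0, 1:]:] x y z w = z" "ev [:0, 1:] x y z w = w"
    by (simp_all add: ev_def)
  show "has_value x y z w vx x" "has_value x y z w vy y" "has_value x y z w vz z" "has_value x y z w vw w"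
    unfolding vx_def vy_def vz_def vw_def using has_value_to_fract[of x y z w] e by metis+
  show "has_value x y z w vt (to_fract [:0, 1:])" "has_value x y z w (cc a) (to_fract [:a:])"
    unfolding vt_def cc_def by (rule has_value_const4)+
qed

lemmas has_value_intros = has_value_to_fract has_value_add has_value_mult has_value_const4
  has_value_numeral has_value_minus has_value_diff has_value_power has_value_vars

lemma has_value_poly:
  assumes f: "f 0 = 0" "\<And>c. has_value x y z w (f c) (g c)" and d: "has_value x y z w d v"
    and G: "G 0 = 0" "\<And>c p. G (pCons c p) = g c + v * G p"
  shows "has_value x y z w (poly (map_poly f p) d) (G p)"
proof (induction p)
  case 0
  show ?case using has_value_const4[of x y z w 0] by (simp add: G const4_hom)
next
  case (pCons c p)
  thus ?case by (simp add: map_poly_pCons f(1) G has_value_add has_value_mult f(2) d)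
qed

text \<open>This lemma turns the chart hypotheses, which involve the substitution \<open>eval4\<close>, into
  statements about polynomial functions.\<close>
lemma has_value_eval4:
  assumes v: "has_value x y z w a a'" "has_value x y z w b b'" "has_value x y z w c c'" "has_value x y z w d d'"
  shows "has_value x y z w (eval4 p a b c d) (ev p a' b' c' d')"
proof -
  have 1: "has_value x y z w (poly (map_poly const4 s) a) (poly s a')" for s
    by (rule has_value_poly[OF _ has_value_const4 v(1)]) (simp_all add: const4_hom)
  have 2: "has_value x y z w (poly (map_poly (\<lambda>s. poly (map_poly const4 s) a) r) b) (poly (poly r [:b':]) a')" for r
    by (rule has_value_poly[OF _ 1 v(2)]) simp_all
  have 3: "has_value x y z w (poly (map_poly (\<lambda>r. poly (map_poly (\<lambda>s. poly (map_poly const4 s) a) r) b) q) c)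
      (poly (poly (poly q [:[:c':]:]) [:b':]) a')" for q
    by (rule has_value_poly[OF _ 2 v(3)]) simp_all
  show ?thesis unfolding eval4_def ev_def
    by (rule has_value_poly[OF _ 3 v(4)]) simp_all
qed

text \<open>The bound applies to each exponent separately, so that sums over all four exponents have the
  same range.\<close>
definition bounded :: "'a::zero poly poly poly poly \<Rightarrow> nat \<Rightarrow> bool" where
  "bounded p N \<longleftrightarrow> (\<forall>i j k l. coeff4 p i j k l \<noteq> 0 \<longrightarrow> i \<le> N \<and> j \<le> N \<and> k \<le> N \<and> l \<le> N)"

lemma bounded_degree:
  assumes "bounded p N"
  shows "degree p \<le> N" "degree (coeff p l) \<le> N" "degree (coeff (coeff p l) k) \<le> N"
    "degree (coeff (coeff (coeff p l) k) j) \<le> N"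
  using assms unfolding bounded_def coeff4_def
  by (auto intro!: degree_le simp: poly_eq_iff) (metis not_less)+

lemma poly_map_poly_eq_sum:
  fixes h :: "'a::zero \<Rightarrow> 'b::idom"
  assumes "degree p \<le> N" "h 0 = 0"
  shows "poly (map_poly h p) c = (\<Sum>l\<le>N. h (coeff p l) * c ^ l)"
proof -
  have "degree (map_poly h p) \<le> N"
    using assms by (intro degree_le) (auto simp: coeff_map_poly coeff_eq_0)
  thus ?thesis by (simp add: poly_eq_sum coeff_map_poly assms)
qed

lemma ev_eq_sum:
  fixes p :: "'a::idom poly poly poly poly"
  assumes "bounded p N"
  shows "ev p x y z w =
    (\<Sum>l\<le>N. \<Sum>k\<le>N. \<Sum>j\<le>N. \<Sum>i\<le>N. coeff4 p i j k l * x ^ i * y ^ j * z ^ k * w ^ l)"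
  unfolding ev_def coeff4_def
  by (simp only: poly_eq_sum[OF bounded_degree(1)[OF assms]] poly_sum poly_mult poly_power
    poly_eq_sum[OF bounded_degree(2)[OF assms]] poly_const_pow poly_pCons poly_0 mult_zero_right add_0_right
    poly_eq_sum[OF bounded_degree(3)[OF assms]] poly_eq_sum[OF bounded_degree(4)[OF assms]] sum_distrib_right)

lemma ev_d_eq_sum:
  fixes p :: pol4
  assumes "bounded p N"
  shows "ev (d_x p) x y z w = (\<Sum>l\<le>N. \<Sum>k\<le>N. \<Sum>j\<le>N. \<Sum>i\<le>N.
      coeff4 p i j k l * (of_nat i * x ^ (i - 1)) * y ^ j * z ^ k * w ^ l)"
    and "ev (d_y p) x y z w = (\<Sum>l\<le>N. \<Sum>k\<le>N. \<Sum>j\<le>N. \<Sum>i\<le>N.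
      coeff4 p i j k l * x ^ i * (of_nat j * y ^ (j - 1)) * z ^ k * w ^ l)"
    and "ev (d_z p) x y z w = (\<Sum>l\<le>N. \<Sum>k\<le>N. \<Sum>j\<le>N. \<Sum>i\<le>N.
      coeff4 p i j k l * x ^ i * y ^ j * (of_nat k * z ^ (k - 1)) * w ^ l)"
    and "ev (d_w p) x y z w = (\<Sum>l\<le>N. \<Sum>k\<le>N. \<Sum>j\<le>N. \<Sum>i\<le>N.
      coeff4 p i j k l * x ^ i * y ^ j * z ^ k * (of_nat l * w ^ (l - 1)))"
  unfolding ev_def coeff4_def d_x_def d_y_def d_z_def d_w_def
  by (simp_all only: poly_map_poly_eq_sum[OF bounded_degree(1)[OF assms]] poly_map_poly_eq_sum[OF bounded_degree(2)[OF assms]]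
    poly_map_poly_eq_sum[OF bounded_degree(3)[OF assms]] pderiv_0 map_poly_0
    poly_pderiv_eq_sum[OF bounded_degree(1)[OF assms]] poly_pderiv_eq_sum[OF bounded_degree(2)[OF assms]]
    poly_pderiv_eq_sum[OF bounded_degree(3)[OF assms]] poly_pderiv_eq_sum[OF bounded_degree(4)[OF assms]]
    poly_eq_sum[OF bounded_degree(1)[OF assms]] poly_sum poly_mult poly_power poly_of_nat of_nat_poly
    poly_eq_sum[OF bounded_degree(2)[OF assms]] poly_const_pow poly_pCons poly_0 mult_zero_right add_0_right
    poly_eq_sum[OF bounded_degree(3)[OF assms]] poly_eq_sum[OF bounded_degree(4)[OF assms]] sum_distrib_right)

text \<open>The step that adds one variable in the proof that every iterated polynomial is bounded.\<close>
lemma bound_coefficients: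
  fixes p :: "'a::zero poly" and P :: "nat \<Rightarrow> 'a \<Rightarrow> bool"
  assumes ex: "\<And>q. \<exists>N. P N q" and mono: "\<And>M N q. P M q \<Longrightarrow> M \<le> N \<Longrightarrow> P N q"
  shows "\<exists>N\<ge>degree p. \<forall>l. P N (coeff p l)"
proof -
  obtain b where b: "\<And>q. P (b q) q" using ex by metis
  define N where "N = degree p + b 0 + (\<Sum>l\<le>degree p. b (coeff p l))"
  have "P N (coeff p l)" for l
  proof (cases "l \<le> degree p")
    case True
    hence "b (coeff p l) \<le> (\<Sum>l\<le>degree p. b (coeff p l))" by (intro member_le_sum) auto
    thus ?thesis by (intro mono[OF b]) (simp add: N_def)
  next
    case False
    hence "coeff p l = 0" by (intro coeff_eq_0) simp
    thus ?thesis using b[of 0] mono[of "b 0" 0 N] by (simp add: N_def)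
  qed
  thus ?thesis unfolding N_def by (intro exI[of _ N]) (auto simp: N_def)
qed

lemma ex_bounded: "\<exists>N. bounded p N"
proof -
  have 1: "\<exists>N. degree q \<le> N" for q :: "'a poly" by auto
  have 2: "\<exists>N\<ge>degree q. \<forall>i. degree (coeff q i) \<le> N" for q :: "'a poly poly"
    by (rule bound_coefficients[where P = "\<lambda>N q. degree q \<le> N"]) auto
  have 3: "\<exists>N\<ge>degree q. \<forall>i. degree (coeff q i) \<le> N \<and> (\<forall>j. degree (coeff (coeff q i) j) \<le> N)"
    for q :: "'a poly poly poly"
    by (rule bound_coefficients[where P = "\<lambda>N q. degree q \<le> N \<and> (\<forall>j. degree (coeff q j) \<le> N)"])
      (use 2 in blast, meson order.trans)
  have "\<exists>N\<ge>degree p. \<forall>i. degree (coeff p i) \<le> N \<and>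
      (\<forall>j. degree (coeff (coeff p i) j) \<le> N \<and> (\<forall>k. degree (coeff (coeff (coeff p i) j) k) \<le> N))"
    by (rule bound_coefficients[where P = "\<lambda>N q. degree q \<le> N \<and> (\<forall>j. degree (coeff q j) \<le> N \<and>
        (\<forall>k. degree (coeff (coeff q j) k) \<le> N))"])
      (use 3 in blast, meson order.trans)
  then obtain N where N: "degree p \<le> N" "\<And>i. degree (coeff p i) \<le> N"
    "\<And>i j. degree (coeff (coeff p i) j) \<le> N" "\<And>i j k. degree (coeff (coeff (coeff p i) j) k) \<le> N"
    by blast
  have "bounded p N"
    unfolding bounded_def coeff4_def
  proof (intro allI impI)
    fix i j k l assume nz: "coeff (coeff (coeff (coeff p l) k) j) i \<noteq> 0"
    hence "i \<le> degree (coeff (coeff (coeff p l) k) j)" by (rule le_degree)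
    moreover from nz have "coeff (coeff (coeff p l) k) j \<noteq> 0" by auto
    hence "j \<le> degree (coeff (coeff p l) k)" by (rule le_degree)
    moreover from nz have "coeff (coeff p l) k \<noteq> 0" by auto
    hence "k \<le> degree (coeff p l)" by (rule le_degree)
    moreover from nz have "coeff p l \<noteq> 0" by auto
    hence "l \<le> degree p" by (rule le_degree)
    ultimately show "i \<le> N \<and> j \<le> N \<and> k \<le> N \<and> l \<le> N" using N by (meson order.trans)
  qed
  thus ?thesis ..
qed

lemma polynomial_function_zero:
  fixes c :: "nat \<Rightarrow> 'a::field_char_0"
  assumes "\<And>x. (\<Sum>i\<le>N. c i * x ^ i) = 0" "i \<le> N"
  shows "c i = 0"
proof -
  define p where "p = (\<Sum>i\<le>N. monom (c i) i)"
  have "poly p x = 0" for x using assms(1)[of x] by (simp add: p_def poly_sum poly_monom)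
  hence "p = 0" using poly_all_0_iff_0 by blast
  moreover have "coeff p i = c i" using assms(2) by (simp add: p_def coeff_sum)
  ultimately show ?thesis by simp
qed

lemma polynomial_function_zero2:
  fixes c :: "nat \<Rightarrow> nat \<Rightarrow> 'a::field_char_0"
  assumes 0: "\<And>x y. (\<Sum>i\<le>N. \<Sum>j\<le>N. c i j * x ^ i * y ^ j) = 0" and ij: "i \<le> N" "j \<le> N"
  shows "c i j = 0"
proof (rule polynomial_function_zero[OF _ ij(2)])
  fix y
  show "(\<Sum>j\<le>N. c i j * y ^ j) = 0"
  proof (rule polynomial_function_zero[OF _ ij(1)])
    show "(\<Sum>i\<le>N. (\<Sum>j\<le>N. c i j * y ^ j) * x ^ i) = 0" for x
      using 0[of x y] by (simp add: sum_distrib_right sum_distrib_left mult_ac)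
  qed
qed

lemma ev_zero_imp_zero:
  fixes p :: "'a::field_char_0 poly poly poly poly"
  assumes "\<And>x y z w. ev p x y z w = 0"
  shows "p = 0"
proof -
  obtain N where N: "bounded p N" using ex_bounded by blast
  have "coeff4 p i j k l = 0" for i j k l
  proof (cases "i \<le> N \<and> j \<le> N \<and> k \<le> N \<and> l \<le> N")
    case True
    hence ij: "i \<le> N" "j \<le> N" "k \<le> N" "l \<le> N" by auto
    show ?thesis
    proof (rule polynomial_function_zero2[OF _ ij(2,1)])
      fix y x
      show "(\<Sum>j\<le>N. \<Sum>i\<le>N. coeff4 p i j k l * y ^ j * x ^ i) = 0"
      proof (rule polynomial_function_zero2[OF _ ij(4,3)])
        show "(\<Sum>l\<le>N. \<Sum>k\<le>N. (\<Sum>j\<le>N. \<Sum>i\<le>N. coeff4 p i j k l * y ^ j * x ^ i) * w ^ l * z ^ k) = 0" for w z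
          using assms[of x y z w] unfolding ev_eq_sum[OF N]
          by (simp add: sum_distrib_right sum_distrib_left mult_ac)
      qed
    qed
  next
    case False
    thus ?thesis using N unfolding bounded_def by blast
  qed
  thus ?thesis by (simp add: poly_eq_iff coeff4_def)
qed

text \<open>A numerator of \<open>q - r\<close> takes the value 0 at every point: there, \<open>q\<close> and \<open>r\<close> have a common value,
  which need not be computed from the chosen fraction.\<close>
lemma has_value_eqI:
  assumes "\<And>x y z w. \<exists>v. has_value x y z w q v \<and> has_value x y z w r v"
  shows "q = r"
proof -
  obtain n m where nm: "q - r = Fract n m" "m \<noteq> 0" by (cases "q - r")
  hence qr: "(q - r) * to_fract m = to_fract n" by (simp add: Fract_conv_to_fract)
  have "ev n x y z w = 0" for x y z w
  proof -
    obtain v where v: "has_value x y z w q v" "has_value x y z w r v" using assms by blast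
    hence "has_value x y z w ((q - r) * to_fract m) ((v - v) * ev m x y z w)"
      by (intro has_value_intros)
    hence "(v - v) * ev m x y z w = ev n x y z w"
      unfolding qr by (rule has_value_unique[OF _ has_value_to_fract])
    thus ?thesis by simp
  qed
  hence "n = 0" by (rule ev_zero_imp_zero)
  thus ?thesis using qr nm by simp
qed

section \<open>The six charts as conditions on polynomial functions\<close>

lemma derivation_minus:
  assumes "derivation d" shows "d (- a) = - d a"
proof -
  have "d (a + - a) = d a + d (- a)" using assms unfolding derivation_def by blast
  thus ?thesis using derivation_0[OF assms] by (simp add: eq_neg_iff_add_eq_0 add.commute)
qed

lemma ddt_rules:
  "ddt H (p + q) = ddt H p + ddt H q" "ddt H (- p) = - ddt H p" "ddt H (p - q) = ddt H p - ddt H q"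
  "ddt H (p * q) = ddt H p * q + p * ddt H q" "ddt H (cc a) = 0" "ddt H 1 = 0"
proof -
  note D = derivation_d[THEN derivation_fract_deriv]
  have add: "ddt H (p + q) = ddt H p + ddt H q" for p q
    using D unfolding derivation_def ddt_def by (simp add: algebra_simps)
  have mult: "ddt H (p * q) = ddt H p * q + p * ddt H q" for p q
    using D unfolding derivation_def ddt_def by (simp add: algebra_simps)
  have der: "derivation (ddt H)" using add mult unfolding derivation_def by blast
  show "ddt H (p + q) = ddt H p + ddt H q" "ddt H (p * q) = ddt H p * q + p * ddt H q"
    by (rule add, rule mult)
  show minus: "ddt H (- p) = - ddt H p" for p by (rule derivation_minus[OF der])
  show "ddt H (p - q) = ddt H p - ddt H q" using add[of p "- q"] minus by simp
  show "ddt H 1 = 0" by (rule derivation_1[OF der])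
  have F: "fract_deriv pderiv (to_fract p) = to_fract (pderiv p)" for p :: "complex poly"
    by (simp add: to_fract_def fract_deriv_Fract derivation_pderiv)
  have E: "fract_deriv d (to_fract p) = to_fract (d p)" if "derivation d" for d and p :: pol4
    using that by (simp add: to_fract_def fract_deriv_Fract derivation_1)
  note z = derivation_0[OF derivation_fract_deriv[OF derivation_pderiv]]
  show "ddt H (cc a) = 0"
    unfolding ddt_def cc_def const4_def
    by (simp_all only: E derivation_d)
      (simp_all add: d_t_def d_x_def d_y_def d_z_def d_w_def map_poly_pCons pderiv_pCons F z)
qed

abbreviation tt :: ct where "tt \<equiv> to_fract [:0, 1:]"
abbreviation ca :: "complex \<Rightarrow> ct" where "ca a \<equiv> to_fract [:a:]"

text \<open>The ordinate of the point is \<open>-s\<close>, which is \<open>0\<close> or \<open>-t\<close>. The left hand side is the derivative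
  of the new coordinate along the flow of \<open>H\<close>.\<close>
lemma chart_x:
  assumes "polynomial_hamiltonian_in H (1 / vx) (- ((vy + s) * vx + cc \<alpha>) * vx) vz vw"
    and s: "ddt H s = const4 e" "\<And>x y z w. has_value x y z w s s'"
  shows "\<exists>Q. \<forall>x y z w. x \<noteq> 0 \<longrightarrow>
    x^2 * ev (d_x H) x y z w - (2 * x * (y + s') + ca \<alpha>) * ev (d_y H) x y z w - e * x^2
      = ev Q (1 / x) (- ((x * (y + s') + ca \<alpha>) * x)) z w"
proof -
  obtain K where K: "ddt H (- ((vy + s) * vx + cc \<alpha>) * vx)
      = - eval4 (d_x K) (1 / vx) (- ((vy + s) * vx + cc \<alpha>) * vx) vz vw"
    using assms(1) unfolding polynomial_hamiltonian_in_def by blast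
  have D: "ddt H (- ((vy + s) * vx + cc \<alpha>) * vx)
    = (to_fract (d_x H) * vx - const4 e * vx - (vy + s) * to_fract (d_y H)) * vx
       - ((vy + s) * vx + cc \<alpha>) * to_fract (d_y H)"
    by (simp add: ddt_rules ddt_vars s algebra_simps)
  show ?thesis
  proof (intro exI[of _ "- d_x K"] allI impI)
    fix x y z w :: ct assume x: "x \<noteq> 0"
    have l: "has_value x y z w (ddt H (- ((vy + s) * vx + cc \<alpha>) * vx))
       ((ev (d_x H) x y z w * x - e * x - (y + s') * ev (d_y H) x y z w) * x
       - ((y + s') * x + ca \<alpha>) * ev (d_y H) x y z w)"
      unfolding D by (intro has_value_intros s)
    have r: "has_value x y z w (- eval4 (d_x K) (1 / vx) (- ((vy + s) * vx + cc \<alpha>) * vx) vz vw)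
       (- ev (d_x K) (1 / x) (- ((y + s') * x + ca \<alpha>) * x) z w)"
      using x by (intro has_value_intros has_value_eval4 has_value_inverse s)
    show "x^2 * ev (d_x H) x y z w - (2 * x * (y + s') + ca \<alpha>) * ev (d_y H) x y z w - e * x^2
      = ev (- d_x K) (1 / x) (- ((x * (y + s') + ca \<alpha>) * x)) z w"
      using has_value_unique[OF l[unfolded K] r] by (simp add: algebra_simps power2_eq_square)
  qed
qed

lemma chart_z:
  assumes "polynomial_hamiltonian_in H vx vy (1 / vz) (- (vw * vz + cc \<alpha>) * vz)"
  shows "\<exists>Q. \<forall>x y z w. z \<noteq> 0 \<longrightarrow>
    z^2 * ev (d_z H) x y z w - (2 * z * w + ca \<alpha>) * ev (d_w H) x y z w
      = ev Q x y (1 / z) (- ((z * w + ca \<alpha>) * z))"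
proof -
  obtain K where K: "ddt H (- (vw * vz + cc \<alpha>) * vz)
      = - eval4 (d_z K) vx vy (1 / vz) (- (vw * vz + cc \<alpha>) * vz)"
    using assms(1) unfolding polynomial_hamiltonian_in_def by blast
  have D: "ddt H (- (vw * vz + cc \<alpha>) * vz)
    = (to_fract (d_z H) * vz - vw * to_fract (d_w H)) * vz - (vw * vz + cc \<alpha>) * to_fract (d_w H)"
    by (simp add: ddt_rules ddt_vars algebra_simps)
  show ?thesis
  proof (intro exI[of _ "- d_z K"] allI impI)
    fix x y z w :: ct assume z: "z \<noteq> 0"
    have l: "has_value x y z w (ddt H (- (vw * vz + cc \<alpha>) * vz))
       ((ev (d_z H) x y z w * z - w * ev (d_w H) x y z w) * z - (w * z + ca \<alpha>) * ev (d_w H) x y z w)"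
      unfolding D by (intro has_value_intros)
    have r: "has_value x y z w (- eval4 (d_z K) vx vy (1 / vz) (- (vw * vz + cc \<alpha>) * vz))
       (- ev (d_z K) x y (1 / z) (- (w * z + ca \<alpha>) * z))"
      using z by (intro has_value_intros has_value_eval4 has_value_inverse)
    show "z^2 * ev (d_z H) x y z w - (2 * z * w + ca \<alpha>) * ev (d_w H) x y z w
      = ev (- d_z K) x y (1 / z) (- ((z * w + ca \<alpha>) * z))"
      using has_value_unique[OF l[unfolded K] r] by (simp add: algebra_simps power2_eq_square)
  qed
qed

text \<open>The roles in the plane \<open>(z, w)\<close> are exchanged: here \<open>w\<close> tends to infinity. As \<open>dw/dt = -H_z\<close>, the
  derivative of the new coordinate is the negative of the left hand side.\<close>
lemma chart_w:
  assumes "polynomial_hamiltonian_in H vx vy (- ((vz - cc a) * vw - cc \<alpha>) * vw) (1 / vw)"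
  shows "\<exists>Q. \<forall>x y z w. w \<noteq> 0 \<longrightarrow>
    w^2 * ev (d_w H) x y z w - (2 * w * (z - ca a) - ca \<alpha>) * ev (d_z H) x y z w
      = ev Q x y (- ((w * (z - ca a) - ca \<alpha>) * w)) (1 / w)"
proof -
  obtain K where K: "ddt H (- ((vz - cc a) * vw - cc \<alpha>) * vw)
      = eval4 (d_w K) vx vy (- ((vz - cc a) * vw - cc \<alpha>) * vw) (1 / vw)"
    using assms(1) unfolding polynomial_hamiltonian_in_def by blast
  have D: "ddt H (- ((vz - cc a) * vw - cc \<alpha>) * vw)
    = ((vz - cc a) * to_fract (d_z H) - to_fract (d_w H) * vw) * vw
      + ((vz - cc a) * vw - cc \<alpha>) * to_fract (d_z H)"
    by (simp add: ddt_rules ddt_vars algebra_simps)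
  show ?thesis
  proof (intro exI[of _ "- d_w K"] allI impI)
    fix x y z w :: ct assume w: "w \<noteq> 0"
    have l: "has_value x y z w (ddt H (- ((vz - cc a) * vw - cc \<alpha>) * vw))
       (((z - ca a) * ev (d_z H) x y z w - ev (d_w H) x y z w * w) * w
         + ((z - ca a) * w - ca \<alpha>) * ev (d_z H) x y z w)"
      unfolding D by (intro has_value_intros)
    have r: "has_value x y z w (eval4 (d_w K) vx vy (- ((vz - cc a) * vw - cc \<alpha>) * vw) (1 / vw))
       (ev (d_w K) x y (- ((z - ca a) * w - ca \<alpha>) * w) (1 / w))"
      using w by (intro has_value_intros has_value_eval4 has_value_inverse)
    show "w^2 * ev (d_w H) x y z w - (2 * w * (z - ca a) - ca \<alpha>) * ev (d_z H) x y z w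
      = ev (- d_w K) x y (- ((w * (z - ca a) - ca \<alpha>) * w)) (1 / w)"
      using has_value_unique[OF l[unfolded K] r] by (simp add: algebra_simps power2_eq_square)
  qed
qed

text \<open>With \<open>z\<close> and \<open>w + y\<close> held fixed, the derivative with respect to \<open>y\<close> is \<open>H_y - H_w\<close>; so this
  is a chart in the plane with the coordinates \<open>(y, x - z)\<close>.\<close>
lemma chart_y:
  assumes "polynomial_hamiltonian_in H (- ((vx - vz) * vy - cc \<alpha>) * vy) (1 / vy) vz (vw + vy)"
  shows "\<exists>Q. \<forall>x y z w. y \<noteq> 0 \<longrightarrow>
    y^2 * (ev (d_y H) x y z w - ev (d_w H) x y z w) - (2 * y * (x - z) - ca \<alpha>) * ev (d_x H) x y z w
      = ev Q (- ((y * (x - z) - ca \<alpha>) * y)) (1 / y) z (w + y)"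
proof -
  obtain K where K: "ddt H (- ((vx - vz) * vy - cc \<alpha>) * vy)
      = eval4 (d_y K) (- ((vx - vz) * vy - cc \<alpha>) * vy) (1 / vy) vz (vw + vy)"
    using assms(1) unfolding polynomial_hamiltonian_in_def by blast
  have D: "ddt H (- ((vx - vz) * vy - cc \<alpha>) * vy)
    = ((vx - vz) * to_fract (d_x H) - (to_fract (d_y H) - to_fract (d_w H)) * vy) * vy
      + ((vx - vz) * vy - cc \<alpha>) * to_fract (d_x H)"
    by (simp add: ddt_rules ddt_vars algebra_simps)
  show ?thesis
  proof (intro exI[of _ "- d_y K"] allI impI)
    fix x y z w :: ct assume y: "y \<noteq> 0"
    have l: "has_value x y z w (ddt H (- ((vx - vz) * vy - cc \<alpha>) * vy))
       (((x - z) * ev (d_x H) x y z w - (ev (d_y H) x y z w - ev (d_w H) x y z w) * y) * y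
         + ((x - z) * y - ca \<alpha>) * ev (d_x H) x y z w)"
      unfolding D by (intro has_value_intros)
    have r: "has_value x y z w (eval4 (d_y K) (- ((vx - vz) * vy - cc \<alpha>) * vy) (1 / vy) vz (vw + vy))
       (ev (d_y K) (- ((x - z) * y - ca \<alpha>) * y) (1 / y) z (w + y))"
      using y by (intro has_value_intros has_value_eval4 has_value_inverse)
    show "y^2 * (ev (d_y H) x y z w - ev (d_w H) x y z w) - (2 * y * (x - z) - ca \<alpha>) * ev (d_x H) x y z w
      = ev (- d_y K) (- ((y * (x - z) - ca \<alpha>) * y)) (1 / y) z (w + y)"
      using has_value_unique[OF l[unfolded K] r] by (simp add: algebra_simps power2_eq_square)
  qed
qed

section \<open>Slices of the Hamiltonian\<close>

lemma sum_swap4: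
  "(\<Sum>a\<in>A. \<Sum>b\<in>B. \<Sum>c\<in>C. \<Sum>d\<in>D. F a b c d) = (\<Sum>c\<in>C. \<Sum>d\<in>D. \<Sum>a\<in>A. \<Sum>b\<in>B. F a b c d)"
proof -
  have "(\<Sum>a\<in>A. \<Sum>b\<in>B. \<Sum>c\<in>C. \<Sum>d\<in>D. F a b c d) = (\<Sum>a\<in>A. \<Sum>c\<in>C. \<Sum>b\<in>B. \<Sum>d\<in>D. F a b c d)"
    by (intro sum.cong refl sum.swap)
  also have "\<dots> = (\<Sum>c\<in>C. \<Sum>a\<in>A. \<Sum>b\<in>B. \<Sum>d\<in>D. F a b c d)" by (rule sum.swap)
  also have "\<dots> = (\<Sum>c\<in>C. \<Sum>a\<in>A. \<Sum>d\<in>D. \<Sum>b\<in>B. F a b c d)" by (intro sum.cong refl sum.swap)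
  also have "\<dots> = (\<Sum>c\<in>C. \<Sum>d\<in>D. \<Sum>a\<in>A. \<Sum>b\<in>B. F a b c d)" by (intro sum.cong refl sum.swap)
  finally show ?thesis .
qed

text \<open>This lemma and the next three fix two of the arguments of a polynomial and put
  the chart coordinates in place of the others. They differ in the pair of arguments that is used
  and in its order.\<close>
lemma ev_in_chart_xy:
  fixes Q :: "'a::field_char_0 poly poly poly poly"
  assumes "\<And>X Y. X \<noteq> 0 \<Longrightarrow> F X Y = ev Q (1 / X) (- ((X * (Y - a) + \<beta>) * X)) z w"
  shows "in_chart a \<beta> F"
proof -
  obtain M where M: "bounded Q M" using ex_bounded by blast
  have e: "ev Q A B z w = (\<Sum>m\<le>M. \<Sum>n\<le>M. (\<Sum>l\<le>M. \<Sum>k\<le>M. coeff4 Q m n k l * z ^ k * w ^ l) * A ^ m * B ^ n)" for A B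
  proof -
    have "ev Q A B z w = (\<Sum>n\<le>M. \<Sum>m\<le>M. \<Sum>l\<le>M. \<Sum>k\<le>M. coeff4 Q m n k l * A ^ m * B ^ n * z ^ k * w ^ l)"
      unfolding ev_eq_sum[OF M] by (rule sum_swap4)
    also have "\<dots> = (\<Sum>m\<le>M. \<Sum>n\<le>M. \<Sum>l\<le>M. \<Sum>k\<le>M. coeff4 Q m n k l * A ^ m * B ^ n * z ^ k * w ^ l)"
      by (rule sum.swap)
    finally show ?thesis by (simp add: sum_distrib_right sum_distrib_left mult_ac)
  qed
  show ?thesis unfolding in_chart_def using assms unfolding e
    by (intro exI[of _ M] exI[of _ "\<lambda>m n. \<Sum>l\<le>M. \<Sum>k\<le>M. coeff4 Q m n k l * z ^ k * w ^ l"]) blast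
qed

lemma ev_in_chart_yx:
  fixes Q :: "'a::field_char_0 poly poly poly poly"
  assumes "\<And>X Y. X \<noteq> 0 \<Longrightarrow> F X Y = ev Q (- ((X * (Y - a) + \<beta>) * X)) (1 / X) z w"
  shows "in_chart a \<beta> F"
proof -
  obtain M where M: "bounded Q M" using ex_bounded by blast
  have e: "ev Q B A z w = (\<Sum>m\<le>M. \<Sum>n\<le>M. (\<Sum>l\<le>M. \<Sum>k\<le>M. coeff4 Q n m k l * z ^ k * w ^ l) * A ^ m * B ^ n)" for A B
  proof -
    have "ev Q B A z w = (\<Sum>m\<le>M. \<Sum>n\<le>M. \<Sum>l\<le>M. \<Sum>k\<le>M. coeff4 Q n m k l * B ^ n * A ^ m * z ^ k * w ^ l)"
      unfolding ev_eq_sum[OF M] by (rule sum_swap4)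
    thus ?thesis by (simp add: sum_distrib_right sum_distrib_left mult_ac)
  qed
  show ?thesis unfolding in_chart_def using assms unfolding e
    by (intro exI[of _ M] exI[of _ "\<lambda>m n. \<Sum>l\<le>M. \<Sum>k\<le>M. coeff4 Q n m k l * z ^ k * w ^ l"]) blast
qed

lemma ev_in_chart_zw:
  fixes Q :: "'a::field_char_0 poly poly poly poly"
  assumes "\<And>X Y. X \<noteq> 0 \<Longrightarrow> F X Y = ev Q x y (1 / X) (- ((X * (Y - a) + \<beta>) * X))"
  shows "in_chart a \<beta> F"
proof -
  obtain M where M: "bounded Q M" using ex_bounded by blast
  have e: "ev Q x y A B = (\<Sum>m\<le>M. \<Sum>n\<le>M. (\<Sum>j\<le>M. \<Sum>i\<le>M. coeff4 Q i j m n * x ^ i * y ^ j) * A ^ m * B ^ n)" for A B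
  proof -
    have "ev Q x y A B = (\<Sum>m\<le>M. \<Sum>n\<le>M. \<Sum>j\<le>M. \<Sum>i\<le>M. coeff4 Q i j m n * x ^ i * y ^ j * A ^ m * B ^ n)"
      unfolding ev_eq_sum[OF M] by (rule sum.swap)
    thus ?thesis by (simp add: sum_distrib_right sum_distrib_left mult_ac)
  qed
  show ?thesis unfolding in_chart_def using assms unfolding e
    by (intro exI[of _ M] exI[of _ "\<lambda>m n. \<Sum>j\<le>M. \<Sum>i\<le>M. coeff4 Q i j m n * x ^ i * y ^ j"]) blast
qed

lemma ev_in_chart_wz:
  fixes Q :: "'a::field_char_0 poly poly poly poly"
  assumes "\<And>X Y. X \<noteq> 0 \<Longrightarrow> F X Y = ev Q x y (- ((X * (Y - a) + \<beta>) * X)) (1 / X)"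
  shows "in_chart a \<beta> F"
proof -
  obtain M where M: "bounded Q M" using ex_bounded by blast
  have e: "ev Q x y B A = (\<Sum>m\<le>M. \<Sum>n\<le>M. (\<Sum>j\<le>M. \<Sum>i\<le>M. coeff4 Q i j n m * x ^ i * y ^ j) * A ^ m * B ^ n)" for A B
    unfolding ev_eq_sum[OF M] by (simp add: sum_distrib_right sum_distrib_left mult_ac)
  show ?thesis unfolding in_chart_def using assms unfolding e
    by (intro exI[of _ M] exI[of _ "\<lambda>m n. \<Sum>j\<le>M. \<Sum>i\<le>M. coeff4 Q i j n m * x ^ i * y ^ j"]) blast
qed

text \<open>The sums stop at 6, the bound on the total degree of \<open>H\<close>; the same holds for \<open>zpoly\<close>.\<close>

definition ypoly :: "pol4 \<Rightarrow> nat \<Rightarrow> nat \<Rightarrow> nat \<Rightarrow> ct poly" where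
  "ypoly H i k l = (\<Sum>j\<le>6. monom (coeff4 H i j k l) j)"

definition zpoly :: "pol4 \<Rightarrow> nat \<Rightarrow> nat \<Rightarrow> nat \<Rightarrow> ct poly" where
  "zpoly H i j l = (\<Sum>k\<le>6. monom (coeff4 H i j k l) k)"

definition xy_slice :: "pol4 \<Rightarrow> ct \<Rightarrow> ct \<Rightarrow> nat \<Rightarrow> ct poly" where
  "xy_slice H z w n = (\<Sum>l\<le>6. \<Sum>k\<le>6. smult (w ^ l * z ^ k) (ypoly H n k l))"

definition zw_slice :: "pol4 \<Rightarrow> ct \<Rightarrow> ct \<Rightarrow> nat \<Rightarrow> ct poly" where
  "zw_slice H x y n = (\<Sum>j\<le>6. \<Sum>i\<le>6. smult (y ^ j * x ^ i) (zpoly H i j n))"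

lemma ev_d_xy_slice:
  assumes "bounded H 6"
  shows "ev (d_x H) x y z w = (\<Sum>n\<le>6. of_nat n * x ^ (n - 1) * poly (xy_slice H z w n) y)"
    and "ev (d_y H) x y z w = (\<Sum>n\<le>6. x ^ n * poly (pderiv (xy_slice H z w n)) y)"
proof -
  have "ev (d_x H) x y z w = (\<Sum>j\<le>6. \<Sum>i\<le>6. \<Sum>l\<le>6. \<Sum>k\<le>6.
      coeff4 H i j k l * (of_nat i * x ^ (i - 1)) * y ^ j * z ^ k * w ^ l)"
    unfolding ev_d_eq_sum[OF assms] by (rule sum_swap4)
  also have "\<dots> = (\<Sum>i\<le>6. \<Sum>j\<le>6. \<Sum>l\<le>6. \<Sum>k\<le>6.
      coeff4 H i j k l * (of_nat i * x ^ (i - 1)) * y ^ j * z ^ k * w ^ l)"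
    by (rule sum.swap)
  also have "\<dots> = (\<Sum>n\<le>6. of_nat n * x ^ (n - 1) * poly (xy_slice H z w n) y)"
  proof (intro sum.cong refl)
    fix i
    have "(\<Sum>j\<le>6. \<Sum>l\<le>6. \<Sum>k\<le>6. coeff4 H i j k l * (of_nat i * x ^ (i - 1)) * y ^ j * z ^ k * w ^ l)
      = (\<Sum>l\<le>6. \<Sum>k\<le>6. \<Sum>j\<le>6. coeff4 H i j k l * (of_nat i * x ^ (i - 1)) * y ^ j * z ^ k * w ^ l)"
      by (subst sum.swap) (intro sum.cong refl sum.swap)
    thus "(\<Sum>j\<le>6. \<Sum>l\<le>6. \<Sum>k\<le>6. coeff4 H i j k l * (of_nat i * x ^ (i - 1)) * y ^ j * z ^ k * w ^ l)
      = of_nat i * x ^ (i - 1) * poly (xy_slice H z w i) y"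
      by (simp add: xy_slice_def ypoly_def poly_sum poly_monom sum_distrib_left sum_distrib_right sum_distrib_left mult_ac)
  qed
  finally show "ev (d_x H) x y z w = (\<Sum>n\<le>6. of_nat n * x ^ (n - 1) * poly (xy_slice H z w n) y)" .
  have "ev (d_y H) x y z w = (\<Sum>j\<le>6. \<Sum>i\<le>6. \<Sum>l\<le>6. \<Sum>k\<le>6.
      coeff4 H i j k l * x ^ i * (of_nat j * y ^ (j - 1)) * z ^ k * w ^ l)"
    unfolding ev_d_eq_sum[OF assms] by (rule sum_swap4)
  also have "\<dots> = (\<Sum>i\<le>6. \<Sum>j\<le>6. \<Sum>l\<le>6. \<Sum>k\<le>6.
      coeff4 H i j k l * x ^ i * (of_nat j * y ^ (j - 1)) * z ^ k * w ^ l)"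
    by (rule sum.swap)
  also have "\<dots> = (\<Sum>n\<le>6. x ^ n * poly (pderiv (xy_slice H z w n)) y)"
  proof (intro sum.cong refl)
    fix i
    have "(\<Sum>j\<le>6. \<Sum>l\<le>6. \<Sum>k\<le>6. coeff4 H i j k l * x ^ i * (of_nat j * y ^ (j - 1)) * z ^ k * w ^ l)
      = (\<Sum>l\<le>6. \<Sum>k\<le>6. \<Sum>j\<le>6. coeff4 H i j k l * x ^ i * (of_nat j * y ^ (j - 1)) * z ^ k * w ^ l)"
      by (subst sum.swap) (intro sum.cong refl sum.swap)
    thus "(\<Sum>j\<le>6. \<Sum>l\<le>6. \<Sum>k\<le>6. coeff4 H i j k l * x ^ i * (of_nat j * y ^ (j - 1)) * z ^ k * w ^ l)
      = x ^ i * poly (pderiv (xy_slice H z w i)) y"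
      by (simp add: xy_slice_def ypoly_def pderiv_sum pderiv_smult pderiv_monom poly_sum poly_monom
          sum_distrib_left sum_distrib_right sum_distrib_left mult_ac)
  qed
  finally show "ev (d_y H) x y z w = (\<Sum>n\<le>6. x ^ n * poly (pderiv (xy_slice H z w n)) y)" .
qed

lemma ev_d_zw_slice:
  assumes "bounded H 6"
  shows "ev (d_w H) x y z w = (\<Sum>n\<le>6. of_nat n * w ^ (n - 1) * poly (zw_slice H x y n) z)"
    and "ev (d_z H) x y z w = (\<Sum>n\<le>6. w ^ n * poly (pderiv (zw_slice H x y n)) z)"
proof -
  show "ev (d_w H) x y z w = (\<Sum>n\<le>6. of_nat n * w ^ (n - 1) * poly (zw_slice H x y n) z)"
    unfolding ev_d_eq_sum[OF assms]
  proof (intro sum.cong refl)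
    fix l
    have "(\<Sum>k\<le>6. \<Sum>j\<le>6. \<Sum>i\<le>6. coeff4 H i j k l * x ^ i * y ^ j * z ^ k * (of_nat l * w ^ (l - 1)))
      = (\<Sum>j\<le>6. \<Sum>i\<le>6. \<Sum>k\<le>6. coeff4 H i j k l * x ^ i * y ^ j * z ^ k * (of_nat l * w ^ (l - 1)))"
      by (subst sum.swap) (intro sum.cong refl sum.swap)
    thus "(\<Sum>k\<le>6. \<Sum>j\<le>6. \<Sum>i\<le>6. coeff4 H i j k l * x ^ i * y ^ j * z ^ k * (of_nat l * w ^ (l - 1)))
      = of_nat l * w ^ (l - 1) * poly (zw_slice H x y l) z"
      by (simp add: zw_slice_def zpoly_def poly_sum poly_monom sum_distrib_left sum_distrib_right sum_distrib_left mult_ac)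
  qed
  show "ev (d_z H) x y z w = (\<Sum>n\<le>6. w ^ n * poly (pderiv (zw_slice H x y n)) z)"
    unfolding ev_d_eq_sum[OF assms]
  proof (intro sum.cong refl)
    fix l
    have "(\<Sum>k\<le>6. \<Sum>j\<le>6. \<Sum>i\<le>6. coeff4 H i j k l * x ^ i * y ^ j * (of_nat k * z ^ (k - 1)) * w ^ l)
      = (\<Sum>j\<le>6. \<Sum>i\<le>6. \<Sum>k\<le>6. coeff4 H i j k l * x ^ i * y ^ j * (of_nat k * z ^ (k - 1)) * w ^ l)"
      by (subst sum.swap) (intro sum.cong refl sum.swap)
    thus "(\<Sum>k\<le>6. \<Sum>j\<le>6. \<Sum>i\<le>6. coeff4 H i j k l * x ^ i * y ^ j * (of_nat k * z ^ (k - 1)) * w ^ l)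
      = w ^ l * poly (pderiv (zw_slice H x y l)) z"
      by (simp add: zw_slice_def zpoly_def pderiv_sum pderiv_smult pderiv_monom poly_sum poly_monom
          sum_distrib_left sum_distrib_right sum_distrib_left mult_ac)
  qed
qed

lemma coeff_ypoly: "coeff (ypoly H i k l) j = (if j \<le> 6 then coeff4 H i j k l else 0)"
  by (simp add: ypoly_def coeff_sum)

lemma coeff_zpoly: "coeff (zpoly H i j l) k = (if k \<le> 6 then coeff4 H i j k l else 0)"
  by (simp add: zpoly_def coeff_sum)

lemma total_degree_imp:
  assumes "total_degree_le H 6"
  shows "i + j + k + l > 6 \<Longrightarrow> coeff4 H i j k l = 0" "bounded H 6"
    "degree (ypoly H i k l) \<le> 6 - i - k - l" "degree (zpoly H i j l) \<le> 6 - i - j - l"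
    "i + k + l > 6 \<Longrightarrow> ypoly H i k l = 0" "i + j + l > 6 \<Longrightarrow> zpoly H i j l = 0"
proof -
  show *: "coeff4 H i j k l = 0" if "i + j + k + l > 6" for i j k l
    using assms that unfolding total_degree_le_def by (meson not_le)
  show "bounded H 6" unfolding bounded_def using * by (metis add.commute add.left_commute not_le trans_less_add1)
  show "degree (ypoly H i k l) \<le> 6 - i - k - l" "degree (zpoly H i j l) \<le> 6 - i - j - l"
    by (auto intro!: degree_le simp: coeff_ypoly coeff_zpoly *)
  show "i + k + l > 6 \<Longrightarrow> ypoly H i k l = 0" "i + j + l > 6 \<Longrightarrow> zpoly H i j l = 0"
    by (auto simp: poly_eq_iff coeff_ypoly coeff_zpoly *)
qed

text \<open>A linear condition on slices which holds at all points holds for the coefficient of each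
  monomial in the two coordinates that were held fixed.\<close>
lemma slices_vanish:
  fixes \<Phi> :: "nat \<Rightarrow> nat \<Rightarrow> ct"
  assumes 0: "\<And>u v. (\<Sum>b\<le>6. \<Sum>a\<le>6. \<Phi> a b * v ^ b * u ^ a) = 0"
    and out: "\<And>a b. a > 6 \<or> b > 6 \<Longrightarrow> \<Phi> a b = 0"
  shows "\<Phi> a b = 0"
  using polynomial_function_zero2[where N = 6 and c = "\<lambda>b a. \<Phi> a b" and i = b and j = a] 0 out
  by (meson not_le)

text \<open>The points \<open>y = 0\<close> and \<open>y = -t\<close> on \<open>x = \<infinity>\<close>. The inhomogeneous term is free of \<open>z\<close> and \<open>w\<close>, so it
  affects only the coefficient of \<open>z^0 w^0\<close>.\<close>
lemma xy_structure:
  assumes H: "total_degree_le H 6"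
    and at0: "\<exists>Q. \<forall>x y z w. x \<noteq> 0 \<longrightarrow>
      x^2 * ev (d_x H) x y z w - (2 * x * (y + 0) + \<alpha>1) * ev (d_y H) x y z w - 0 * x^2
        = ev Q (1 / x) (- ((x * (y + 0) + \<alpha>1) * x)) z w"
    and att: "\<exists>Q. \<forall>x y z w. x \<noteq> 0 \<longrightarrow>
      x^2 * ev (d_x H) x y z w - (2 * x * (y + t) + \<alpha>0) * ev (d_y H) x y z w - 1 * x^2
        = ev Q (1 / x) (- ((x * (y + t) + \<alpha>0) * x)) z w"
    and t: "t \<noteq> 0"
  shows "n \<ge> 3 \<Longrightarrow> ypoly H n k l = 0"
    "poly (ypoly H 2 k l) 0 = 0" "poly (ypoly H 2 k l) (- t) = 0"
    "poly (ypoly H 1 k l) 0 = \<alpha>1 * poly (pderiv (ypoly H 2 k l)) 0"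
    "poly (ypoly H 1 k l) (- t) = \<alpha>0 * poly (pderiv (ypoly H 2 k l)) (- t) + (if k = 0 \<and> l = 0 then 1 else 0)"
proof -
  note deg = total_degree_imp[OF H]
  define f where "f = xy_slice H"
  have loc: "local_condition 6 (f z w) (- s) \<beta> e"
    if ex: "\<exists>Q. \<forall>x y z w. x \<noteq> 0 \<longrightarrow>
      x^2 * ev (d_x H) x y z w - (2 * x * (y + s) + \<beta>) * ev (d_y H) x y z w - e * x^2
        = ev Q (1 / x) (- ((x * (y + s) + \<beta>) * x)) z w" for s \<beta> e z w
  proof -
    obtain Q where Q: "\<And>x y z w. x \<noteq> 0 \<Longrightarrow>
      x^2 * ev (d_x H) x y z w - (2 * x * (y + s) + \<beta>) * ev (d_y H) x y z w - e * x^2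
        = ev Q (1 / x) (- ((x * (y + s) + \<beta>) * x)) z w" using ex by blast
    show ?thesis unfolding local_condition_def
    proof (rule ev_in_chart_xy)
      fix X Y :: ct assume X: "X \<noteq> 0"
      show "(\<Sum>n\<le>6. X\<^sup>2 * (of_nat n * X ^ (n - 1)) * poly (f z w n) Y
            - (2 * X * (Y - - s) + \<beta>) * X ^ n * poly (pderiv (f z w n)) Y) - e * X\<^sup>2
        = ev Q (1 / X) (- ((X * (Y - - s) + \<beta>) * X)) z w"
        using Q[OF X, of Y z w] unfolding ev_d_xy_slice[OF deg(2)] f_def
        by (simp add: sum_subtractf sum_distrib_left mult.assoc)
    qed
  qed
  have loc0: "local_condition 6 (f z w) 0 \<alpha>1 0" for z w using loc[OF at0] by simp
  note loct = loc[OF att]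
  have df: "degree (f z w n) \<le> 6 - n" for z w n
    unfolding f_def xy_slice_def
    by (intro degree_sum_le order.trans[OF degree_smult_le] order.trans[OF deg(3)]) auto
  have f0: "f z w n = 0" if "n > 6" for z w n
    unfolding f_def xy_slice_def using that by (simp add: deg(5))
  have 0: "0 \<noteq> - t" using t by simp
  have top: "f z w n = 0" if "n \<ge> 3" for z w n
    by (rule two_point_degree[OF 0 df f0 loc0 loct that]) 
  have d6: "degree (f z w n) \<le> 6" for z w n using df[of z w n] by simp
  have fl: "poly (f z w n) a = (\<Sum>l\<le>6. \<Sum>k\<le>6. poly (ypoly H n k l) a * w ^ l * z ^ k)" for z w n a
    unfolding f_def xy_slice_def by (simp add: poly_sum mult_ac)
  have fl': "poly (pderiv (f z w n)) a = (\<Sum>l\<le>6. \<Sum>k\<le>6. poly (pderiv (ypoly H n k l)) a * w ^ l * z ^ k)" for z w n a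
    unfolding f_def xy_slice_def by (simp add: pderiv_sum pderiv_smult poly_sum mult_ac)
  note q0 = local_condition_quadratic[OF loc0 d6 _ top]
  note qt = local_condition_quadratic[OF loct d6 _ top]
  show "ypoly H n k l = 0" if "n \<ge> 3"
  proof -
    have "poly (ypoly H n k l) a = 0" for a
    proof (rule slices_vanish)
      show "(\<Sum>l\<le>6. \<Sum>k\<le>6. poly (ypoly H n k l) a * w ^ l * z ^ k) = 0" for z w
        using top[OF that, of z w] fl[of z w n a] by simp
    qed (auto simp: deg(5))
    thus ?thesis using poly_all_0_iff_0 by blast
  qed
  show "poly (ypoly H 2 k l) 0 = 0"
    by (rule slices_vanish) (use q0(1) in \<open>auto simp: deg(5) fl[symmetric]\<close>)
  show "poly (ypoly H 2 k l) (- t) = 0"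
    by (rule slices_vanish) (use qt(1) in \<open>auto simp: deg(5) fl[symmetric]\<close>)
  have "poly (ypoly H 1 k l) 0 - \<alpha>1 * poly (pderiv (ypoly H 2 k l)) 0 = 0"
  proof (rule slices_vanish)
    show "(\<Sum>l\<le>6. \<Sum>k\<le>6. (poly (ypoly H 1 k l) 0 - \<alpha>1 * poly (pderiv (ypoly H 2 k l)) 0) * w ^ l * z ^ k) = 0" for z w
    proof -
      have "(\<Sum>l\<le>6. \<Sum>k\<le>6. (poly (ypoly H 1 k l) 0 - \<alpha>1 * poly (pderiv (ypoly H 2 k l)) 0) * w ^ l * z ^ k)
        = poly (f z w 1) 0 - \<alpha>1 * poly (pderiv (f z w 2)) 0"
        unfolding fl fl' by (simp add: sum_distrib_left sum_subtractf[symmetric] left_diff_distrib mult.assoc)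
      thus ?thesis using q0(2)[of z w] by simp
    qed
  qed (auto simp: deg(5))
  thus "poly (ypoly H 1 k l) 0 = \<alpha>1 * poly (pderiv (ypoly H 2 k l)) 0" by simp
  define \<delta> :: "nat \<Rightarrow> nat \<Rightarrow> ct" where "\<delta> k l = (if k = 0 \<and> l = 0 then 1 else 0)" for k l
  have \<delta>: "(\<Sum>l\<le>6. \<Sum>k\<le>6. \<delta> k l * w ^ l * z ^ k) = 1" for z w
  proof -
    have "(\<Sum>l\<le>6. \<Sum>k\<le>6. \<delta> k l * w ^ l * z ^ k) = (\<Sum>l\<le>(6::nat). \<Sum>k\<le>(6::nat). if k = 0 then if l = 0 then 1 else 0 else 0)"
      by (intro sum.cong refl) (auto simp: \<delta>_def)
    thus ?thesis by (simp add: sum.delta)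
  qed
  have "poly (ypoly H 1 k l) (- t) - \<alpha>0 * poly (pderiv (ypoly H 2 k l)) (- t) - \<delta> k l = 0"
  proof (rule slices_vanish)
    show "(\<Sum>l\<le>6. \<Sum>k\<le>6. (poly (ypoly H 1 k l) (- t) - \<alpha>0 * poly (pderiv (ypoly H 2 k l)) (- t) - \<delta> k l) * w ^ l * z ^ k) = 0" for z w
    proof -
      have "(\<Sum>l\<le>6. \<Sum>k\<le>6. (poly (ypoly H 1 k l) (- t) - \<alpha>0 * poly (pderiv (ypoly H 2 k l)) (- t) - \<delta> k l) * w ^ l * z ^ k)
        = poly (f z w 1) (- t) - \<alpha>0 * poly (pderiv (f z w 2)) (- t) - 1"
        unfolding fl fl' \<delta>[of w z, symmetric]
        by (simp add: sum_distrib_left sum_subtractf[symmetric] left_diff_distrib mult.assoc)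
      thus ?thesis using qt(2)[of z w] by simp
    qed
  qed (auto simp: deg(5) \<delta>_def)
  thus "poly (ypoly H 1 k l) (- t) = \<alpha>0 * poly (pderiv (ypoly H 2 k l)) (- t) + (if k = 0 \<and> l = 0 then 1 else 0)"
    by (simp add: \<delta>_def algebra_simps)
qed

text \<open>The points \<open>z = 0\<close> and \<open>z = 1\<close> on \<open>w = \<infinity>\<close> bound the degree in \<open>w\<close> by 2; then
  \<open>quadratic_at_infinity\<close> applies to the point \<open>w = 0\<close> on \<open>z = \<infinity>\<close>.\<close>
lemma zw_structure:
  assumes H: "total_degree_le H 6"
    and at0: "\<exists>Q. \<forall>x y z w. w \<noteq> 0 \<longrightarrow>
      w^2 * ev (d_w H) x y z w - (2 * w * (z - 0) - \<alpha>5) * ev (d_z H) x y z w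
        = ev Q x y (- ((w * (z - 0) - \<alpha>5) * w)) (1 / w)"
    and at1: "\<exists>Q. \<forall>x y z w. w \<noteq> 0 \<longrightarrow>
      w^2 * ev (d_w H) x y z w - (2 * w * (z - 1) - \<alpha>4) * ev (d_z H) x y z w
        = ev Q x y (- ((w * (z - 1) - \<alpha>4) * w)) (1 / w)"
    and inf: "\<exists>Q. \<forall>x y z w. z \<noteq> 0 \<longrightarrow>
      z^2 * ev (d_z H) x y z w - (2 * z * w + \<alpha>3) * ev (d_w H) x y z w
        = ev Q x y (1 / z) (- ((z * w + \<alpha>3) * z))"
  shows "n \<ge> 3 \<Longrightarrow> zpoly H i j n = 0"
    "poly (zpoly H i j 2) 0 = 0" "poly (zpoly H i j 2) 1 = 0"
    "poly (zpoly H i j 1) 0 = - \<alpha>5 * poly (pderiv (zpoly H i j 2)) 0"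
    "poly (zpoly H i j 1) 1 = - \<alpha>4 * poly (pderiv (zpoly H i j 2)) 1"
    "k \<ge> 4 \<Longrightarrow> coeff (zpoly H i j 1) k = 0" "k \<ge> 3 \<Longrightarrow> coeff (zpoly H i j 0) k = 0"
    "coeff (zpoly H i j 1) 3 = 2 * \<alpha>3 * coeff (zpoly H i j 2) 4"
    "coeff (zpoly H i j 0) 2 = \<alpha>3^2 * coeff (zpoly H i j 2) 4"
    "coeff (zpoly H i j 0) 1 = \<alpha>3 * coeff (zpoly H i j 1) 2 - \<alpha>3^2 * coeff (zpoly H i j 2) 3"
proof -
  note deg = total_degree_imp[OF H]
  define f where "f = zw_slice H"
  have loc: "local_condition 6 (f x y) a (- \<beta>) 0"
    if ex: "\<exists>Q. \<forall>x y z w. w \<noteq> 0 \<longrightarrow>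
      w^2 * ev (d_w H) x y z w - (2 * w * (z - a) - \<beta>) * ev (d_z H) x y z w
        = ev Q x y (- ((w * (z - a) - \<beta>) * w)) (1 / w)" for a \<beta> x y
  proof -
    obtain Q where Q: "\<And>x y z w. w \<noteq> 0 \<Longrightarrow>
      w^2 * ev (d_w H) x y z w - (2 * w * (z - a) - \<beta>) * ev (d_z H) x y z w
        = ev Q x y (- ((w * (z - a) - \<beta>) * w)) (1 / w)" using ex by blast
    show ?thesis unfolding local_condition_def
    proof (rule ev_in_chart_wz)
      fix X Y :: ct assume X: "X \<noteq> 0"
      show "(\<Sum>n\<le>6. X\<^sup>2 * (of_nat n * X ^ (n - 1)) * poly (f x y n) Y
            - (2 * X * (Y - a) + - \<beta>) * X ^ n * poly (pderiv (f x y n)) Y) - 0 * X\<^sup>2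
        = ev Q x y (- ((X * (Y - a) + - \<beta>) * X)) (1 / X)"
        using Q[OF X, of x y Y] unfolding ev_d_zw_slice[OF deg(2)] f_def
        by (simp add: sum_subtractf sum_distrib_left mult.assoc)
    qed
  qed
  have loc0: "local_condition 6 (f x y) 0 (- \<alpha>5) 0" for x y by (rule loc[OF at0])
  have loc1: "local_condition 6 (f x y) 1 (- \<alpha>4) 0" for x y by (rule loc[OF at1])
  have df: "degree (f x y n) \<le> 6 - n" for x y n
    unfolding f_def zw_slice_def
    by (intro degree_sum_le order.trans[OF degree_smult_le] order.trans[OF deg(4)]) auto
  have f0: "f x y n = 0" if "n > 6" for x y n
    unfolding f_def zw_slice_def using that by (simp add: deg(6))
  have top: "f x y n = 0" if "n \<ge> 3" for x y n
    by (rule two_point_degree[OF zero_neq_one df f0 loc0 loc1 that])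
  have d6: "degree (f x y n) \<le> 6" for x y n using df[of x y n] by simp
  have fl: "poly (f x y n) a = (\<Sum>j\<le>6. \<Sum>i\<le>6. poly (zpoly H i j n) a * y ^ j * x ^ i)" for x y n a
    unfolding f_def zw_slice_def by (simp add: poly_sum mult_ac)
  have fl': "poly (pderiv (f x y n)) a = (\<Sum>j\<le>6. \<Sum>i\<le>6. poly (pderiv (zpoly H i j n)) a * y ^ j * x ^ i)" for x y n a
    unfolding f_def zw_slice_def by (simp add: pderiv_sum pderiv_smult poly_sum mult_ac)
  have fc: "coeff (f x y n) k = (\<Sum>j\<le>6. \<Sum>i\<le>6. coeff (zpoly H i j n) k * y ^ j * x ^ i)" for x y n k
    unfolding f_def zw_slice_def by (simp add: coeff_sum mult_ac)
  note q0 = local_condition_quadratic[OF loc0 d6 _ top]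
  note q1 = local_condition_quadratic[OF loc1 d6 _ top]
  show "zpoly H i j n = 0" if "n \<ge> 3"
  proof -
    have "poly (zpoly H i j n) a = 0" for a
      by (rule slices_vanish) (use top[OF that] in \<open>auto simp: deg(6) fl[symmetric]\<close>)
    thus ?thesis using poly_all_0_iff_0 by blast
  qed
  show "poly (zpoly H i j 2) 0 = 0"
    by (rule slices_vanish) (use q0(1) in \<open>auto simp: deg(6) fl[symmetric]\<close>)
  show "poly (zpoly H i j 2) 1 = 0"
    by (rule slices_vanish) (use q1(1) in \<open>auto simp: deg(6) fl[symmetric]\<close>)
  have lin: "\<Phi> i j - c * \<Psi> i j = 0" if F: "\<And>x y. F x y = c * G x y"
     "\<And>x y. F x y = (\<Sum>j\<le>6. \<Sum>i\<le>6. \<Phi> i j * y ^ j * x ^ i)"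
     "\<And>x y. G x y = (\<Sum>j\<le>6. \<Sum>i\<le>6. \<Psi> i j * y ^ j * x ^ i)"
     "\<And>i j. i > 6 \<or> j > 6 \<Longrightarrow> \<Phi> i j = 0 \<and> \<Psi> i j = 0" for F G \<Phi> \<Psi> and c :: ct
  proof (rule slices_vanish)
    show "(\<Sum>j\<le>6. \<Sum>i\<le>6. (\<Phi> i j - c * \<Psi> i j) * y ^ j * x ^ i) = 0" for x y
    proof -
      have "(\<Sum>j\<le>6. \<Sum>i\<le>6. (\<Phi> i j - c * \<Psi> i j) * y ^ j * x ^ i) = F x y - c * G x y"
        unfolding F(2,3) by (simp add: sum_distrib_left sum_subtractf[symmetric] left_diff_distrib mult.assoc)
      thus ?thesis by (simp add: F(1))
    qed
  qed (use F(4) in auto)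
  have "poly (zpoly H i j 1) 0 - (- \<alpha>5) * poly (pderiv (zpoly H i j 2)) 0 = 0"
    by (rule lin[OF _ fl fl']) (use q0(2) in \<open>auto simp: deg(6)\<close>)
  thus "poly (zpoly H i j 1) 0 = - \<alpha>5 * poly (pderiv (zpoly H i j 2)) 0" by (simp add: eq_neg_iff_add_eq_0)
  have "poly (zpoly H i j 1) 1 - (- \<alpha>4) * poly (pderiv (zpoly H i j 2)) 1 = 0"
    by (rule lin[OF _ fl fl']) (use q1(2) in \<open>auto simp: deg(6)\<close>)
  thus "poly (zpoly H i j 1) 1 = - \<alpha>4 * poly (pderiv (zpoly H i j 2)) 1" by (simp add: eq_neg_iff_add_eq_0)
  have chart: "in_chart 0 \<alpha>3 (\<lambda>X Y. X^2 * (poly (pderiv (f x y 0)) X + poly (pderiv (f x y 1)) X * Y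
       + poly (pderiv (f x y 2)) X * Y^2)
     - (2 * X * Y + \<alpha>3) * (poly (f x y 1) X + 2 * poly (f x y 2) X * Y))" for x y
  proof -
    obtain Q where Q: "\<And>x y z w. z \<noteq> 0 \<Longrightarrow>
      z^2 * ev (d_z H) x y z w - (2 * z * w + \<alpha>3) * ev (d_w H) x y z w
        = ev Q x y (1 / z) (- ((z * w + \<alpha>3) * z))" using inf by blast
    have six: "(\<Sum>n\<le>6. g n) = g 0 + g 1 + g 2" if "\<And>n. n \<ge> 3 \<Longrightarrow> g n = (0::ct)" for g :: "nat \<Rightarrow> ct"
    proof -
      have "(\<Sum>n\<le>6. g n) = (\<Sum>n\<le>2. g n)" using that by (intro sum.mono_neutral_right) auto
      thus ?thesis by (simp add: numeral_2_eq_2)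
    qed
    show ?thesis
    proof (rule ev_in_chart_zw)
      fix X Y :: ct assume X: "X \<noteq> 0"
      have z: "ev (d_z H) x y X Y = poly (pderiv (f x y 0)) X + poly (pderiv (f x y 1)) X * Y
         + poly (pderiv (f x y 2)) X * Y^2"
        unfolding ev_d_zw_slice[OF deg(2)] f_def[symmetric] by (subst six) (simp_all add: top mult.commute)
      have w: "ev (d_w H) x y X Y = poly (f x y 1) X + 2 * poly (f x y 2) X * Y"
        unfolding ev_d_zw_slice[OF deg(2)] f_def[symmetric] by (subst six) (simp_all add: top mult_ac)
      show "X^2 * (poly (pderiv (f x y 0)) X + poly (pderiv (f x y 1)) X * Y
         + poly (pderiv (f x y 2)) X * Y^2)
       - (2 * X * Y + \<alpha>3) * (poly (f x y 1) X + 2 * poly (f x y 2) X * Y)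
        = ev Q x y (1 / X) (- ((X * (Y - 0) + \<alpha>3) * X))"
        using Q[OF X, of x y Y] unfolding z w by simp
    qed
  qed
  note qi = quadratic_at_infinity[OF chart]
  show "k \<ge> 4 \<Longrightarrow> coeff (zpoly H i j 1) k = 0"
    by (rule slices_vanish) (use qi(2) in \<open>auto simp: deg(6) fc[symmetric]\<close>)
  show "k \<ge> 3 \<Longrightarrow> coeff (zpoly H i j 0) k = 0"
    by (rule slices_vanish) (use qi(1) in \<open>auto simp: deg(6) fc[symmetric]\<close>)
  have "coeff (zpoly H i j 1) 3 - (2 * \<alpha>3) * coeff (zpoly H i j 2) 4 = 0"
    by (rule lin[OF _ fc fc]) (use qi(4) in \<open>auto simp: deg(6)\<close>)
  thus "coeff (zpoly H i j 1) 3 = 2 * \<alpha>3 * coeff (zpoly H i j 2) 4" by simp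
  have "coeff (zpoly H i j 0) 2 - \<alpha>3^2 * coeff (zpoly H i j 2) 4 = 0"
    by (rule lin[OF _ fc fc]) (use qi(5) in \<open>auto simp: deg(6)\<close>)
  thus "coeff (zpoly H i j 0) 2 = \<alpha>3^2 * coeff (zpoly H i j 2) 4" by simp
  have "(coeff (zpoly H i j 0) 1 - \<alpha>3 * coeff (zpoly H i j 1) 2) - (- (\<alpha>3^2)) * coeff (zpoly H i j 2) 3 = 0"
  proof (rule lin[where F = "\<lambda>x y. coeff (f x y 0) 1 - \<alpha>3 * coeff (f x y 1) 2"])
    show "coeff (f x y 0) 1 - \<alpha>3 * coeff (f x y 1) 2 = (- (\<alpha>3^2)) * coeff (f x y 2) 3" for x y
      using qi(6)[of x y] by simp
    show "coeff (f x y 0) 1 - \<alpha>3 * coeff (f x y 1) 2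
      = (\<Sum>j\<le>6. \<Sum>i\<le>6. (coeff (zpoly H i j 0) 1 - \<alpha>3 * coeff (zpoly H i j 1) 2) * y ^ j * x ^ i)" for x y
      unfolding fc by (simp add: sum_distrib_left sum_subtractf[symmetric] left_diff_distrib mult.assoc)
  qed (rule fc, auto simp: deg(6))
  thus "coeff (zpoly H i j 0) 1 = \<alpha>3 * coeff (zpoly H i j 1) 2 - \<alpha>3^2 * coeff (zpoly H i j 2) 3"
    by (simp add: algebra_simps)
qed

section \<open>Elimination of the coefficients\<close>

lemma linear_with_two_zeros:
  fixes f :: "'a::idom poly"
  assumes "degree f \<le> 1" "poly f a = 0" "poly f b = 0" "a \<noteq> b"
  shows "f = 0"
proof -
  have f: "poly f x = coeff f 0 + coeff f 1 * x" for x
    using poly_eq_sum[OF assms(1), of x] by simp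
  have "coeff f 1 * (a - b) = poly f a - poly f b" unfolding f by (simp add: algebra_simps)
  hence "coeff f 1 * (a - b) = 0" using assms(2,3) by simp
  hence c1: "coeff f 1 = 0" using assms(4) by simp
  hence "coeff f 0 = 0" using f[of a] assms(2) by simp
  thus ?thesis using c1 assms(1) by (metis One_nat_def le_Suc_eq le_zero_eq leading_coeff_0_iff)
qed

lemma poly_eq_low:
  fixes f :: "'a::idom poly"
  assumes "\<And>i. i \<ge> 4 \<Longrightarrow> coeff f i = 0"
  shows "poly f x = coeff f 0 + coeff f 1 * x + coeff f 2 * x^2 + coeff f 3 * x^3"
    "poly (pderiv f) x = coeff f 1 + 2 * coeff f 2 * x + 3 * coeff f 3 * x^2"
proof -
  have d: "degree f \<le> 3" by (rule degree_le) (use assms in auto)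
  show "poly f x = coeff f 0 + coeff f 1 * x + coeff f 2 * x^2 + coeff f 3 * x^3"
    "poly (pderiv f) x = coeff f 1 + 2 * coeff f 2 * x + 3 * coeff f 3 * x^2"
    unfolding poly_eq_sum[OF d] poly_pderiv_eq_sum[OF d] by (simp_all add: eval_nat_numeral)
qed

text \<open>The six charts in the form in which they are used: over the field of constants \<open>\<complex>(t)\<close>, with
  \<open>t\<close> and the parameters as elements of that field.\<close>
locale regular_hamiltonian =
  fixes H :: pol4 and t \<alpha>0 \<alpha>1 \<alpha>2 \<alpha>3 \<alpha>4 \<alpha>5 :: ct
  assumes degree: "total_degree_le H 6" and t: "t \<noteq> 0"
    and chart0: "\<exists>Q. \<forall>x y z w. x \<noteq> 0 \<longrightarrow>
      x^2 * ev (d_x H) x y z w - (2 * x * (y + t) + \<alpha>0) * ev (d_y H) x y z w - 1 * x^2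
        = ev Q (1 / x) (- ((x * (y + t) + \<alpha>0) * x)) z w"
    and chart1: "\<exists>Q. \<forall>x y z w. x \<noteq> 0 \<longrightarrow>
      x^2 * ev (d_x H) x y z w - (2 * x * (y + 0) + \<alpha>1) * ev (d_y H) x y z w - 0 * x^2
        = ev Q (1 / x) (- ((x * (y + 0) + \<alpha>1) * x)) z w"
    and chart2: "\<exists>Q. \<forall>x y z w. y \<noteq> 0 \<longrightarrow>
      y^2 * (ev (d_y H) x y z w - ev (d_w H) x y z w) - (2 * y * (x - z) - \<alpha>2) * ev (d_x H) x y z w
        = ev Q (- ((y * (x - z) - \<alpha>2) * y)) (1 / y) z (w + y)"
    and chart3: "\<exists>Q. \<forall>x y z w. z \<noteq> 0 \<longrightarrow>
      z^2 * ev (d_z H) x y z w - (2 * z * w + \<alpha>3) * ev (d_w H) x y z w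
        = ev Q x y (1 / z) (- ((z * w + \<alpha>3) * z))"
    and chart4: "\<exists>Q. \<forall>x y z w. w \<noteq> 0 \<longrightarrow>
      w^2 * ev (d_w H) x y z w - (2 * w * (z - 1) - \<alpha>4) * ev (d_z H) x y z w
        = ev Q x y (- ((w * (z - 1) - \<alpha>4) * w)) (1 / w)"
    and chart5: "\<exists>Q. \<forall>x y z w. w \<noteq> 0 \<longrightarrow>
      w^2 * ev (d_w H) x y z w - (2 * w * (z - 0) - \<alpha>5) * ev (d_z H) x y z w
        = ev Q x y (- ((w * (z - 0) - \<alpha>5) * w)) (1 / w)"
begin

abbreviation "h \<equiv> coeff4 H"
abbreviation "Y \<equiv> ypoly H"
abbreviation "Z \<equiv> zpoly H"

lemmas deg = total_degree_imp[OF degree]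
lemmas xy = xy_structure[OF degree chart1 chart0 t]
lemmas zw = zw_structure[OF degree chart5 chart4 chart3]

lemma cY: "coeff (Y i k l) j = h i j k l"
  by (simp add: coeff_ypoly deg(1))

lemma cZ: "coeff (Z i j l) k = h i j k l"
  by (simp add: coeff_zpoly deg(1))

text \<open>The coefficient of \<open>x^2 z^k w^l\<close> has the zeros \<open>0\<close> and \<open>-t\<close> as a polynomial in \<open>y\<close>, that of
  \<open>x^2 y^j w^l\<close> with \<open>l = 1, 2\<close> has the zeros \<open>0\<close> and \<open>1\<close> as a polynomial in \<open>z\<close>. The total degree 6
  does not allow both. The coefficient of \<open>x^2 y^j w^0\<close> is then constant in \<open>z\<close> by the chart at
  \<open>z = \<infinity>\<close>.\<close>
lemma h_x2:
  assumes kl: "k > 0 \<or> l > 0"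
  shows "h 2 j k l = 0"
proof -
  have Z2: "Z 2 j 2 = 0" for j
  proof (rule poly_eqI)
    fix k
    show "coeff (Z 2 j 2) k = coeff 0 k"
    proof (cases "k = 0")
      case True
      thus ?thesis using zw(2)[of 2 j] by (simp add: poly_0_coeff_0)
    next
      case False
      have "degree (Y 2 k 2) \<le> 1" using deg(3)[of 2 k 2] False by simp
      hence "Y 2 k 2 = 0" by (rule linear_with_two_zeros[OF _ xy(2,3)]) (use t in simp)
      thus ?thesis by (metis cY cZ coeff_0)
    qed
  qed
  have Z1: "Z 2 j 1 = 0" for j
  proof -
    have "h 2 j k 1 = 0" if "k \<ge> 2" for k
    proof -
      have "degree (Y 2 k 1) \<le> 1" using deg(3)[of 2 k 1] that by simp
      hence "Y 2 k 1 = 0" by (rule linear_with_two_zeros[OF _ xy(2,3)]) (use t in simp)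
      thus ?thesis by (metis cY coeff_0)
    qed
    hence "degree (Z 2 j 1) \<le> 1" by (intro degree_le) (simp add: cZ)
    moreover have "poly (Z 2 j 1) 0 = 0" "poly (Z 2 j 1) 1 = 0" unfolding zw(4,5) by (simp_all add: Z2)
    ultimately show ?thesis by (rule linear_with_two_zeros) simp
  qed
  have Z0: "coeff (Z 2 j 0) k = 0" if "k > 0" for j k
  proof -
    consider "k = 1" | "k = 2" | "k \<ge> 3" using \<open>k > 0\<close> by linarith
    thus ?thesis by cases (use zw(10)[of 2 j] zw(9)[of 2 j] zw(7)[of k 2 j] Z1 Z2 in auto)
  qed
  consider "l = 0" "k > 0" | "l = 1" | "l = 2" | "l \<ge> 3" using kl by linarith
  thus ?thesis
    by cases (use Z0 Z1 Z2 zw(1) in \<open>simp_all flip: cZ\<close>)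
qed

lemma Y_x2_eq_0: "k > 0 \<or> l > 0 \<Longrightarrow> Y 2 k l = 0"
  by (rule poly_eqI) (simp add: cY h_x2)

text \<open>The same comparison of degrees for the factor \<open>x\<close>. Degree 6 now leaves
  multiples of \<open>z (z - 1) w + \<alpha>3 z\<close>, besides terms without \<open>z\<close> and \<open>w\<close>.\<close>
lemma Z_x1:
  shows "l \<ge> 2 \<Longrightarrow> Z 1 j l = 0"
    and "h 1 j 0 1 = 0" "h 1 j 1 1 = - h 1 j 2 1" "k \<ge> 3 \<Longrightarrow> h 1 j k 1 = 0"
    and "h 1 j 1 0 = \<alpha>3 * h 1 j 2 1" "k \<ge> 2 \<Longrightarrow> h 1 j k 0 = 0"
    and "poly (Y 1 2 1) 0 = 0" "poly (Y 1 2 1) (- t) = 0"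
proof -
  have zeros: "poly (Y 1 k l) 0 = 0" "poly (Y 1 k l) (- t) = 0" if "k > 0 \<or> l > 0" for k l
    using that unfolding xy(4,5) by (auto simp: Y_x2_eq_0)
  show "poly (Y 1 2 1) 0 = 0" "poly (Y 1 2 1) (- t) = 0" by (rule zeros, simp)+
  have vanish: "h 1 j k l = 0" if "k > 0 \<or> l > 0" "5 - k - l \<le> 1" for j k l
  proof -
    have "degree (Y 1 k l) \<le> 1" using deg(3)[of 1 k l] that by simp
    hence "Y 1 k l = 0" by (rule linear_with_two_zeros[OF _ zeros]) (use that t in auto)
    thus ?thesis by (metis cY coeff_0)
  qed
  have Z2: "Z 1 j 2 = 0" for j
  proof -
    have "degree (Z 1 j 2) \<le> 1"
      by (intro degree_le allI impI) (auto simp: cZ[unfolded One_nat_def] intro!: vanish[unfolded One_nat_def])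
    thus ?thesis by (rule linear_with_two_zeros[OF _ zw(2,3)]) simp
  qed
  show "l \<ge> 2 \<Longrightarrow> Z 1 j l = 0" using zw(1) Z2 by (cases "l = 2") auto
  show high: "h 1 j k 1 = 0" if "k \<ge> 3" for k by (rule vanish) (use that in auto)
  have c: "coeff (Z 1 j 1) k = 0" if "k \<ge> 3" for k using high[OF that] by (simp only: cZ)
  have e: "poly (Z 1 j 1) a = coeff (Z 1 j 1) 0 + coeff (Z 1 j 1) 1 * a + coeff (Z 1 j 1) 2 * a^2" for a
    using poly_eq_low(1)[of "Z 1 j 1" a] c by simp
  have "poly (Z 1 j 1) 0 = 0" "poly (Z 1 j 1) 1 = 0" unfolding zw(4,5) Z2 by simp_all
  thus 0: "h 1 j 0 1 = 0" and "h 1 j 1 1 = - h 1 j 2 1"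
    unfolding e by (simp_all add: cZ eq_neg_iff_add_eq_0)
  show "h 1 j 1 0 = \<alpha>3 * h 1 j 2 1" using zw(10)[of 1 j] unfolding Z2 by (simp add: cZ)
  show "k \<ge> 2 \<Longrightarrow> h 1 j k 0 = 0"
    using zw(7)[of k 1 j] zw(9)[of 1 j] unfolding Z2 by (cases "k = 2") (auto simp: cZ)
qed

text \<open>In the plane \<open>(y, x - z)\<close> the Hamiltonian is considered as a polynomial in \<open>y\<close> after the
  substitution \<open>w = W - y\<close>, for fixed values of \<open>z\<close> and \<open>W\<close>. \<open>xwcoeff i l z\<close> is the coefficient of
  \<open>x^i w^l\<close> before this substitution, and \<open>xcoeff i z W\<close> below that of \<open>x^i\<close> after it.\<close>
definition xwcoeff :: "nat \<Rightarrow> nat \<Rightarrow> ct \<Rightarrow> ct poly" where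
  "xwcoeff i l z = (\<Sum>j\<le>6. monom (poly (Z i j l) z) j)"

lemma coeff_xwcoeff: "coeff (xwcoeff i l z) j = poly (Z i j l) z"
  by (simp add: xwcoeff_def coeff_sum deg(6))

definition xcoeff :: "nat \<Rightarrow> ct \<Rightarrow> ct \<Rightarrow> ct poly" where
  "xcoeff i z W = xwcoeff i 0 z + [:W, -1:] * xwcoeff i 1 z + [:W, -1:]^2 * xwcoeff i 2 z"

lemma coeff_xcoeff:
  "coeff (xcoeff i z W) 0 = poly (Z i 0 0) z + W * poly (Z i 0 1) z + W^2 * poly (Z i 0 2) z"
  "coeff (xcoeff i z W) 1 = poly (Z i 1 0) z + W * poly (Z i 1 1) z - poly (Z i 0 1) z
    + W^2 * poly (Z i 1 2) z - 2 * W * poly (Z i 0 2) z"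
  "coeff (xcoeff i z W) (Suc (Suc n)) = poly (Z i (Suc (Suc n)) 0) z + W * poly (Z i (Suc (Suc n)) 1) z
    - poly (Z i (Suc n) 1) z + W^2 * poly (Z i (Suc (Suc n)) 2) z
    - 2 * W * poly (Z i (Suc n) 2) z + poly (Z i n 2) z"
  unfolding xcoeff_def power2_eq_square mult.assoc
  by (simp_all add: coeff_xwcoeff algebra_simps)

lemma h_eq_0_if_x3: "i \<ge> 3 \<Longrightarrow> h i j k l = 0"
  using xy(1)[of i k l] cY[of i k l j] by simp

lemma sum_upto_two:
  fixes g :: "nat \<Rightarrow> ct"
  assumes "\<And>n. n \<ge> 3 \<Longrightarrow> g n = 0"
  shows "(\<Sum>n\<le>6. g n) = g 0 + g 1 + g 2"
proof -
  have "(\<Sum>n\<le>6. g n) = (\<Sum>n\<le>2. g n)" using assms by (intro sum.mono_neutral_right) auto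
  thus ?thesis by (simp add: numeral_2_eq_2)
qed

lemma sum_by_x_powers:
  defines "T \<equiv> \<lambda>b z i l. \<Sum>j\<le>6. b j * poly (Z i j l) z"
  defines "S \<equiv> \<lambda>b c z i. c 0 * T b z i 0 + c 1 * T b z i 1 + c 2 * T b z i 2"
  shows "(\<Sum>l\<le>6. \<Sum>k\<le>6. \<Sum>j\<le>6. \<Sum>i\<le>6. h i j k l * a i * b j * z ^ k * c l)
    = a 0 * S b c z 0 + a 1 * S b c z 1 + a 2 * S b c z 2"
proof -
  have pZ: "poly (Z i j l) z = (\<Sum>k\<le>6. h i j k l * z ^ k)" for i j l
    by (simp add: zpoly_def poly_sum poly_monom)
  have Z0: "Z i j l = 0" if "i \<ge> 3 \<or> l \<ge> 3" for i j l
    using that zw(1) by (auto simp: poly_eq_iff cZ h_eq_0_if_x3)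
  have T0: "T b z i l = 0" if "i \<ge> 3 \<or> l \<ge> 3" for i l
    unfolding T_def using Z0[OF that] by simp
  have "(\<Sum>l\<le>6. \<Sum>k\<le>6. \<Sum>j\<le>6. \<Sum>i\<le>6. h i j k l * a i * b j * z ^ k * c l)
    = (\<Sum>l\<le>6. \<Sum>i\<le>6. \<Sum>j\<le>6. \<Sum>k\<le>6. h i j k l * a i * b j * z ^ k * c l)"
  proof (rule sum.cong[OF refl])
    fix l
    have "(\<Sum>k\<le>6. \<Sum>j\<le>6. \<Sum>i\<le>6. h i j k l * a i * b j * z ^ k * c l)
      = (\<Sum>k\<le>6. \<Sum>i\<le>6. \<Sum>j\<le>6. h i j k l * a i * b j * z ^ k * c l)"
      by (intro sum.cong refl sum.swap)
    also have "\<dots> = (\<Sum>i\<le>6. \<Sum>k\<le>6. \<Sum>j\<le>6. h i j k l * a i * b j * z ^ k * c l)"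
      by (rule sum.swap)
    also have "\<dots> = (\<Sum>i\<le>6. \<Sum>j\<le>6. \<Sum>k\<le>6. h i j k l * a i * b j * z ^ k * c l)"
      by (intro sum.cong refl sum.swap)
    finally show "(\<Sum>k\<le>6. \<Sum>j\<le>6. \<Sum>i\<le>6. h i j k l * a i * b j * z ^ k * c l)
      = (\<Sum>i\<le>6. \<Sum>j\<le>6. \<Sum>k\<le>6. h i j k l * a i * b j * z ^ k * c l)" .
  qed
  also have "\<dots> = (\<Sum>i\<le>6. \<Sum>l\<le>6. \<Sum>j\<le>6. \<Sum>k\<le>6. h i j k l * a i * b j * z ^ k * c l)"
    by (rule sum.swap)
  also have "\<dots> = (\<Sum>i\<le>6. a i * (\<Sum>l\<le>6. c l * T b z i l))"
    unfolding T_def pZ by (simp add: sum_distrib_left sum_distrib_right mult_ac)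
  also have "\<dots> = (\<Sum>i\<le>6. a i * S b c z i)"
    unfolding S_def by (intro sum.cong refl arg_cong2[of _ _ _ _ times] sum_upto_two) (simp add: T0)
  also have "\<dots> = a 0 * S b c z 0 + a 1 * S b c z 1 + a 2 * S b c z 2"
    by (rule sum_upto_two) (simp add: S_def T0)
  finally show ?thesis .
qed

lemma poly_xwcoeff: "poly (xwcoeff i l z) y = (\<Sum>j\<le>6. y ^ j * poly (Z i j l) z)"
  "poly (pderiv (xwcoeff i l z)) y = (\<Sum>j\<le>6. (of_nat j * y ^ (j - 1)) * poly (Z i j l) z)"
  by (simp_all add: xwcoeff_def poly_sum poly_monom pderiv_sum pderiv_monom mult_ac)

lemma poly_xcoeff:
  "poly (xcoeff i z W) y = poly (xwcoeff i 0 z) y + (W - y) * poly (xwcoeff i 1 z) y + (W - y)^2 * poly (xwcoeff i 2 z) y"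
  "poly (pderiv (xcoeff i z W)) y = poly (pderiv (xwcoeff i 0 z)) y
     + (W - y) * poly (pderiv (xwcoeff i 1 z)) y - poly (xwcoeff i 1 z) y
     + (W - y)^2 * poly (pderiv (xwcoeff i 2 z)) y - 2 * (W - y) * poly (xwcoeff i 2 z) y"
proof -
  define L where "L = [:W, -1:]"
  have L: "poly L y = W - y" "pderiv L = [:-1:]" by (simp_all add: L_def pderiv_pCons)
  show "poly (xcoeff i z W) y = poly (xwcoeff i 0 z) y + (W - y) * poly (xwcoeff i 1 z) y + (W - y)^2 * poly (xwcoeff i 2 z) y"
    unfolding xcoeff_def L_def[symmetric] by (simp add: L)
  show "poly (pderiv (xcoeff i z W)) y = poly (pderiv (xwcoeff i 0 z)) y
     + (W - y) * poly (pderiv (xwcoeff i 1 z)) y - poly (xwcoeff i 1 z) y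
     + (W - y)^2 * poly (pderiv (xwcoeff i 2 z)) y - 2 * (W - y) * poly (xwcoeff i 2 z) y"
    unfolding xcoeff_def L_def[symmetric] power2_eq_square
    by (simp add: L pderiv_add pderiv_mult algebra_simps)
qed

lemma ev_d_xcoeff:
  "ev (d_x H) x y z (W - y) = poly (xcoeff 1 z W) y + 2 * x * poly (xcoeff 2 z W) y"
  "ev (d_y H) x y z (W - y) - ev (d_w H) x y z (W - y)
     = poly (pderiv (xcoeff 0 z W)) y + x * poly (pderiv (xcoeff 1 z W)) y + x^2 * poly (pderiv (xcoeff 2 z W)) y"
  unfolding ev_d_eq_sum[OF deg(2)] sum_by_x_powers poly_xwcoeff[symmetric] poly_xcoeff
  by (simp_all add: algebra_simps)

text \<open>Substituting \<open>x = z + Y\<close> turns the coefficients of \<open>1, x, x^2\<close> into the coefficients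
  \<open>g0, g1, g2\<close> of \<open>1, Y, Y^2\<close>, which brings the last chart into the form of
  \<open>quadratic_at_infinity\<close>.\<close>
lemma chart2_in_chart:
  defines "g0 \<equiv> \<lambda>z W. xcoeff 0 z W + smult z (xcoeff 1 z W) + smult (z^2) (xcoeff 2 z W)"
    and "g1 \<equiv> \<lambda>z W. xcoeff 1 z W + smult (2 * z) (xcoeff 2 z W)"
    and "g2 \<equiv> \<lambda>z W. xcoeff 2 z W"
  shows "in_chart 0 (- \<alpha>2) (\<lambda>X Y. X^2 * (poly (pderiv (g0 z W)) X + poly (pderiv (g1 z W)) X * Y
       + poly (pderiv (g2 z W)) X * Y^2)
     - (2 * X * Y + (- \<alpha>2)) * (poly (g1 z W) X + 2 * poly (g2 z W) X * Y))"
proof -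
  obtain Q where Q: "\<And>x y z w. y \<noteq> 0 \<Longrightarrow>
      y^2 * (ev (d_y H) x y z w - ev (d_w H) x y z w) - (2 * y * (x - z) - \<alpha>2) * ev (d_x H) x y z w
        = ev Q (- ((y * (x - z) - \<alpha>2) * y)) (1 / y) z (w + y)" using chart2 by blast
  show ?thesis
  proof (rule ev_in_chart_yx)
    fix X Y :: ct assume X: "X \<noteq> 0"
    show "X^2 * (poly (pderiv (g0 z W)) X + poly (pderiv (g1 z W)) X * Y
       + poly (pderiv (g2 z W)) X * Y^2)
     - (2 * X * Y + (- \<alpha>2)) * (poly (g1 z W) X + 2 * poly (g2 z W) X * Y)
     = ev Q (- ((X * (Y - 0) + - \<alpha>2) * X)) (1 / X) z W"
      using Q[OF X, of "Y + z" z "W - X"] unfolding ev_d_xcoeff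
      by (simp add: g0_def g1_def g2_def pderiv_add pderiv_smult power2_eq_square algebra_simps)
  qed
qed

lemmas chart2_coeffs = quadratic_at_infinity[OF chart2_in_chart]

end

text \<open>Used to compare the coefficients of \<open>W\<close> and of \<open>z\<close> in the equations of the last chart.\<close>
lemma quadratic_function_zero:
  fixes p q r :: "'a::field_char_0"
  assumes "\<And>W. p + W * q + W^2 * r = 0"
  shows "p = 0" "q = 0" "r = 0"
proof -
  show p: "p = 0" using assms[of 0] by simp
  have "q + r = 0" "- q + r = 0" using assms[of 1] assms[of "-1"] p by simp_all
  hence "2 * r = 0" "2 * q = 0" by (simp_all add: algebra_simps eq_neg_iff_add_eq_0)
  thus "q = 0" "r = 0" by simp_all
qed

context regular_hamiltonian
begin

lemma coeff_xcoeff_ge2: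
  assumes "n \<ge> 2"
  shows "coeff (xcoeff i z W) n = (poly (Z i n 0) z - poly (Z i (n - 1) 1) z + poly (Z i (n - 2) 2) z)
    + W * (poly (Z i n 1) z - 2 * poly (Z i (n - 1) 2) z) + W^2 * poly (Z i n 2) z"
proof -
  obtain m where "n = Suc (Suc m)" using assms by (metis add_2_eq_Suc le_Suc_ex)
  thus ?thesis using coeff_xcoeff(3)[of i z W m] by (simp add: algebra_simps)
qed

lemma Z_x2: "Z 2 j l = (if l = 0 then [:h 2 j 0 0:] else 0)"
  by (rule poly_eqI) (auto simp: cZ h_x2 coeff_pCons split: nat.splits)

lemma coeff_xcoeff_x2: "coeff (xcoeff 2 z W) n = h 2 n 0 0"
proof -
  consider "n = 0" | "n = 1" | "n \<ge> 2" by linarith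
  thus ?thesis by cases (simp_all add: coeff_xcoeff[unfolded One_nat_def] coeff_xcoeff_ge2 Z_x2)
qed

text \<open>The chart in the plane \<open>(y, x - z)\<close> makes the coefficient of \<open>y^3 (x - z)\<close> independent of \<open>z\<close> and \<open>W\<close>. The
  term \<open>x y^2 z^2 w\<close> would contribute \<open>-z^2\<close>, because \<open>w = W - y\<close>. So the coefficient of \<open>x z^2 w\<close> is at most
  linear in \<open>y\<close>, and it has the zeros \<open>0\<close> and \<open>-t\<close>.\<close>
lemma h_x1_z2: "h 1 j 2 1 = 0"
proof -
  have e: "coeff (xcoeff 1 z W) 3 + 2 * z * h 2 3 0 0 = - 2 * \<alpha>2 * h 2 4 0 0" for z W
    using chart2_coeffs(4)[of z W] by (simp add: coeff_xcoeff_x2)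
  have Z130: "poly (Z 1 3 0) z = h 1 3 0 0 + h 1 3 1 0 * z" for z
    by (subst poly_eq_low) (simp_all add: cZ[unfolded One_nat_def] Z_x1(6)[unfolded One_nat_def])
  have Z121: "poly (Z 1 2 1) z = h 1 2 2 1 * (z^2 - z)" for z
  proof (subst poly_eq_low)
    show "coeff (Z 1 2 1) i = 0" if "4 \<le> i" for i
      using that Z_x1(4)[of i 2] by (simp only: cZ)
    show "coeff (Z 1 2 1) 0 + coeff (Z 1 2 1) 1 * z + coeff (Z 1 2 1) 2 * z^2 + coeff (Z 1 2 1) 3 * z^3
      = h 1 2 2 1 * (z^2 - z)"
      unfolding cZ Z_x1(2,3) using Z_x1(4)[of 3 2] by (simp add: algebra_simps)
  qed
  have "(h 1 3 0 0 + 2 * \<alpha>2 * h 2 4 0 0) + z * (h 1 3 1 0 + h 1 2 2 1 + 2 * h 2 3 0 0) + z^2 * (- h 1 2 2 1) = 0" for z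
  proof -
    have "coeff (xcoeff 1 z 0) 3 = h 1 3 0 0 + h 1 3 1 0 * z - h 1 2 2 1 * (z^2 - z)"
      using coeff_xcoeff_ge2[of 3 1 z 0] Z_x1(1)[of 2 1]
      by (simp add: Z130[unfolded One_nat_def] Z121[unfolded One_nat_def])
    hence "h 1 3 0 0 + h 1 3 1 0 * z - h 1 2 2 1 * (z^2 - z) + 2 * z * h 2 3 0 0 + 2 * \<alpha>2 * h 2 4 0 0 = 0"
      using e[of z 0] by simp
    thus ?thesis by (simp add: algebra_simps)
  qed
  from quadratic_function_zero(3)[OF this] have d2: "h 1 2 2 1 = 0" by simp
  have "degree (Y 1 2 1) \<le> 1"
  proof (rule degree_le, intro allI impI)
    fix i :: nat assume "1 < i"
    thus "coeff (Y 1 2 1) i = 0" unfolding cY using d2 deg(1)[of 1 i 2 1] by (cases "i = 2") auto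
  qed
  hence "Y 1 2 1 = 0" by (rule linear_with_two_zeros[OF _ Z_x1(7,8)]) (use t in simp)
  thus ?thesis by (metis cY coeff_0)
qed

lemma Z_x1': "Z 1 j l = (if l = 0 then [:h 1 j 0 0:] else 0)"
proof (rule poly_eqI)
  fix k
  have 1: "h 1 j k 1 = 0"
  proof -
    consider "k = 0" | "k = 1" | "k = 2" | "k \<ge> 3" by linarith
    thus ?thesis by cases (use Z_x1(2,3,4) h_x1_z2 in auto)
  qed
  have 0: "h 1 j k 0 = 0" if "k > 0"
    using that Z_x1(5,6) h_x1_z2 by (cases "k = 1") auto
  show "coeff (Z 1 j l) k = coeff (if l = 0 then [:h 1 j 0 0:] else 0) k"
  proof (cases "l \<ge> 2")
    case True
    thus ?thesis using Z_x1(1)[of l j] by simp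
  next
    case False
    hence "l = 0 \<or> l = 1" by linarith
    thus ?thesis unfolding cZ using 0 1 by (auto simp: coeff_pCons split: nat.splits)
  qed
qed

lemma coeff_xcoeff_x1: "coeff (xcoeff 1 z W) n = h 1 n 0 0"
proof -
  consider "n = 0" | "n = 1" | "n \<ge> 2" by linarith
  thus ?thesis by cases (simp_all add: coeff_xcoeff[unfolded One_nat_def] coeff_xcoeff_ge2 Z_x1'[unfolded One_nat_def])
qed

text \<open>Since \<open>g1\<close> is the coefficient of \<open>x\<close> plus \<open>2 z\<close> times that of \<open>x^2\<close>, and neither
  depends on \<open>z\<close>, both inherit the bound 3 on the degree of \<open>g1\<close> in \<open>y\<close>. The coefficient of \<open>g1\<close> at
  \<open>y^3\<close> is a multiple of that of \<open>x^2 y^4\<close> in \<open>H\<close> and therefore vanishes too.\<close>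
lemma y_degree_x12:
  "n \<ge> 3 \<Longrightarrow> h 1 n 0 0 = 0" "n \<ge> 3 \<Longrightarrow> h 2 n 0 0 = 0"
proof -
  have big: "h 1 n 0 0 = 0 \<and> h 2 n 0 0 = 0" if "n \<ge> 4" for n
  proof -
    have e: "h 1 n 0 0 + z * (2 * h 2 n 0 0) + z^2 * 0 = 0" for z
      using chart2_coeffs(2)[OF that, of z 0] by (simp add: coeff_xcoeff_x1[unfolded One_nat_def] coeff_xcoeff_x2 algebra_simps)
    from quadratic_function_zero[OF e] show ?thesis by simp
  qed
  have e: "h 1 3 0 0 + z * (2 * h 2 3 0 0) + z^2 * 0 = 0" for z
    using chart2_coeffs(4)[of z 0] big[of 4]
    by (simp add: coeff_xcoeff_x1[unfolded One_nat_def] coeff_xcoeff_x2 algebra_simps)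
  from quadratic_function_zero[OF e] have "h 1 3 0 0 = 0" "h 2 3 0 0 = 0" by simp_all
  thus "n \<ge> 3 \<Longrightarrow> h 1 n 0 0 = 0" "n \<ge> 3 \<Longrightarrow> h 2 n 0 0 = 0"
    using big[of n] by (cases "n = 3"; simp)+
qed

lemma poly_eq_0I: "(\<And>z. poly p z = 0) \<Longrightarrow> p = (0 :: ct poly)"
  using poly_all_0_iff_0 by blast

lemma xcoeff_0_high: "n \<ge> 3 \<Longrightarrow> coeff (xcoeff 0 z W) n = 0"
  using chart2_coeffs(1)[of n z W] y_degree_x12[of n]
  by (simp add: coeff_xcoeff_x1[unfolded One_nat_def] coeff_xcoeff_x2)

text \<open>The equations of the last chart at \<open>y^n\<close>, read as polynomials in \<open>W\<close>. They relate the
  coefficients of \<open>y^n\<close>, \<open>y^(n - 1) w\<close> and \<open>y^(n - 2) w^2\<close>, since \<open>w = W - y\<close>.\<close>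
lemma Z_x0_w2: "j \<ge> 1 \<Longrightarrow> Z 0 j 2 = 0"
  and Z_x0_w1: "j \<ge> 2 \<Longrightarrow> Z 0 j 1 = 0"
  and Z_x0_w0: "j \<ge> 3 \<Longrightarrow> Z 0 j 0 = 0"
  and Z_x0_yw: "poly (Z 0 1 1) z = 2 * poly (Z 0 0 2) z"
  and Z_x0_y2: "poly (Z 0 2 0) z + z * h 1 2 0 0 + z^2 * h 2 2 0 0 = poly (Z 0 0 2) z"
  and Z_x0_y: "poly (Z 0 1 0) z + z * h 1 1 0 0 + z^2 * h 2 1 0 0
    = poly (Z 0 0 1) z - \<alpha>2 * (h 1 2 0 0 + 2 * z * h 2 2 0 0)"
proof -
  have n1: "(poly (Z 0 1 0) z - poly (Z 0 0 1) z + z * h 1 1 0 0 + z^2 * h 2 1 0 0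
        + \<alpha>2 * (h 1 2 0 0 + 2 * z * h 2 2 0 0))
      + W * (poly (Z 0 1 1) z - 2 * poly (Z 0 0 2) z) + W^2 * poly (Z 0 1 2) z = 0" for z W
  proof -
    have "coeff (xcoeff 0 z W) 1 + z * h 1 1 0 0 + z^2 * h 2 1 0 0 = - \<alpha>2 * (h 1 2 0 0 + 2 * z * h 2 2 0 0)"
      using chart2_coeffs(6)[of z W] y_degree_x12(2)[of 3] by (simp add: coeff_xcoeff_x1[unfolded One_nat_def] coeff_xcoeff_x2)
    hence "coeff (xcoeff 0 z W) 1 + z * h 1 1 0 0 + z^2 * h 2 1 0 0 + \<alpha>2 * (h 1 2 0 0 + 2 * z * h 2 2 0 0) = 0"
      by simp
    thus ?thesis unfolding coeff_xcoeff(2) by (simp add: algebra_simps)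
  qed
  have n2: "(poly (Z 0 2 0) z - poly (Z 0 1 1) z + poly (Z 0 0 2) z + z * h 1 2 0 0 + z^2 * h 2 2 0 0)
      + W * (poly (Z 0 2 1) z - 2 * poly (Z 0 1 2) z) + W^2 * poly (Z 0 2 2) z = 0" for z W
    using chart2_coeffs(5)[of z W] coeff_xcoeff_ge2[of 2 0 z W] y_degree_x12(2)[of 4]
    by (simp add: coeff_xcoeff_x1[unfolded One_nat_def] coeff_xcoeff_x2 algebra_simps)
  have n3: "(poly (Z 0 n 0) z - poly (Z 0 (n - 1) 1) z + poly (Z 0 (n - 2) 2) z)
    + W * (poly (Z 0 n 1) z - 2 * poly (Z 0 (n - 1) 2) z) + W^2 * poly (Z 0 n 2) z = 0" if "n \<ge> 3" for n z W
    using xcoeff_0_high[OF that, of z W] coeff_xcoeff_ge2[of n 0 z W] that by simp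
  note q1 = quadratic_function_zero[OF n1] and q2 = quadratic_function_zero[OF n2]
    and q3 = quadratic_function_zero[OF n3]
  show w2: "Z 0 j 2 = 0" if "j \<ge> 1" for j
  proof (rule poly_eq_0I)
    fix z
    consider "j = 1" | "j = 2" | "j \<ge> 3" using \<open>j \<ge> 1\<close> by linarith
    thus "poly (Z 0 j 2) z = 0" by cases (use q1(3) q2(3) q3(3) in auto)
  qed
  show w1: "Z 0 j 1 = 0" if "j \<ge> 2" for j
  proof (rule poly_eq_0I)
    fix z
    consider "j = 2" | "j \<ge> 3" using \<open>j \<ge> 2\<close> by linarith
    thus "poly (Z 0 j 1) z = 0"
      by cases (use q2(2)[of z] q3(2)[of j z] w2[of 1] w2[of "j - 1"] in auto)
  qed
  show "Z 0 j 0 = 0" if "j \<ge> 3" for j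
    by (rule poly_eq_0I) (use q3(1)[OF that] w1[of "j - 1"] w2[of "j - 2"] that in auto)
  show yw: "poly (Z 0 1 1) z = 2 * poly (Z 0 0 2) z" for z using q1(2)[of z] by simp
  show "poly (Z 0 2 0) z + z * h 1 2 0 0 + z^2 * h 2 2 0 0 = poly (Z 0 0 2) z"
    using q2(1)[of z] yw[of z] by (simp add: algebra_simps eq_neg_iff_add_eq_0)
  show "poly (Z 0 1 0) z + z * h 1 1 0 0 + z^2 * h 2 1 0 0
    = poly (Z 0 0 1) z - \<alpha>2 * (h 1 2 0 0 + 2 * z * h 2 2 0 0)"
    using q1(1)[of z] by (simp add: algebra_simps eq_neg_iff_add_eq_0)
qed

text \<open>The coefficient of \<open>w^2\<close> equals that of \<open>y^2\<close> with \<open>x\<close> replaced by \<open>z\<close>; it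
  vanishes at \<open>z = 0\<close> and \<open>z = 1\<close>, which makes it \<open>\<kappa> z (z - 1)\<close>. All other coefficients follow from the
  values at the finite points and from the equation of the last chart at \<open>y\<close>. The coefficient of \<open>x y\<close>
  is obtained in two ways, from the point \<open>y = -t\<close> and from the last chart; their agreement is the
  equation that fixes \<open>\<kappa>\<close>.\<close>
lemma coefficients_determined:
  defines "\<kappa> \<equiv> h 2 2 0 0"
  assumes sum: "\<alpha>0 + \<alpha>1 + 2 * \<alpha>2 + 2 * \<alpha>3 + \<alpha>4 + \<alpha>5 = 1"
  shows "\<kappa> * t = 1" "h 2 0 0 0 = 0" "h 2 1 0 0 = 1" "h 1 2 0 0 = - \<kappa>" "h 1 0 0 0 = \<alpha>1"
    "h 1 1 0 0 = - \<kappa> * (2 * \<alpha>2 + 2 * \<alpha>3 + \<alpha>4 + \<alpha>5) - 1"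
    "Z 0 0 2 = [:0, - \<kappa>, \<kappa>:]" "Z 0 1 1 = [:0, - 2 * \<kappa>, 2 * \<kappa>:]" "Z 0 2 0 = 0"
    "Z 0 0 1 = [:\<kappa> * \<alpha>5, - \<kappa> * (\<alpha>4 + \<alpha>5) - 1, 1:]"
    "Z 0 1 0 = [:\<kappa> * (\<alpha>2 + \<alpha>5), 2 * \<kappa> * \<alpha>3:]" "Z 0 0 0 = [:h 0 0 0 0, \<alpha>3:]"
proof -
  have peq: "p = q" if "\<And>z. poly p z = poly q z" for p q :: "ct poly"
    using that by (simp add: poly_eq_poly_eq_iff[symmetric] fun_eq_iff)
  have zero: "Z 0 1 2 = 0" "Z 0 2 2 = 0" "Z 0 2 1 = 0"
    by (rule Z_x0_w2 Z_x0_w1, simp)+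
  \<comment> \<open>the terms \<open>y^2 w\<close> and \<open>y^2 w^2\<close> are absent, so the chart at \<open>z = \<infinity>\<close> leaves only a constant\<close>
  have Z020: "Z 0 2 0 = [:h 0 2 0 0:]"
  proof (rule poly_eqI)
    fix k :: nat
    consider "k = 0" | "k = 1" | "k = 2" | "k \<ge> 3" by linarith
    thus "coeff (Z 0 2 0) k = coeff [:h 0 2 0 0:] k"
    proof cases
      case 1 thus ?thesis by (simp add: cZ)
    next
      case 2 thus ?thesis using zw(10)[of 0 2] unfolding zero by simp
    next
      case 3 thus ?thesis using zw(9)[of 0 2] unfolding zero by (simp add: numeral_2_eq_2)
    next
      case 4 thus ?thesis using zw(7)[of k 0 2] by (simp add: coeff_pCons split: nat.splits)
    qed
  qed
  have v: "poly (Z 0 0 2) z = h 0 2 0 0 + z * h 1 2 0 0 + z^2 * \<kappa>" for z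
    using Z_x0_y2[of z] unfolding Z020 \<kappa>_def by simp
  have c0: "h 0 2 0 0 = 0" using v[of 0] zw(2)[of 0 0] by simp
  have e12: "h 1 2 0 0 = - \<kappa>" using v[of 1] zw(3)[of 0 0] c0 by (simp add: eq_neg_iff_add_eq_0)
  show "h 1 2 0 0 = - \<kappa>" by (rule e12)
  show "Z 0 2 0 = 0" using Z020 c0 by simp
  show Z002: "Z 0 0 2 = [:0, - \<kappa>, \<kappa>:]"
    by (rule peq) (simp add: v c0 e12[unfolded One_nat_def] algebra_simps power2_eq_square)
  show Z011: "Z 0 1 1 = [:0, - 2 * \<kappa>, 2 * \<kappa>:]"
    by (rule peq) (simp add: Z_x0_yw[unfolded One_nat_def] Z002 algebra_simps)
  have Y2: "poly (Y 2 0 0) y = h 2 0 0 0 + h 2 1 0 0 * y + \<kappa> * y^2"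
     "poly (pderiv (Y 2 0 0)) y = h 2 1 0 0 + 2 * \<kappa> * y" for y
    by (subst poly_eq_low; simp add: cY[unfolded One_nat_def] y_degree_x12 \<kappa>_def)+
  have Y1: "poly (Y 1 0 0) y = h 1 0 0 0 + h 1 1 0 0 * y - \<kappa> * y^2" for y
    by (subst poly_eq_low; simp add: cY[unfolded One_nat_def] y_degree_x12[unfolded One_nat_def] e12[unfolded One_nat_def])
  show e20: "h 2 0 0 0 = 0" using xy(2)[of 0 0] by (simp add: Y2)
  have "t * (\<kappa> * t - h 2 1 0 0) = 0" using xy(3)[of 0 0] by (simp add: Y2 e20 power2_eq_square algebra_simps)
  hence e21: "h 2 1 0 0 = \<kappa> * t" using t by simp
  have e10: "h 1 0 0 0 = \<alpha>1 * (\<kappa> * t)" using xy(4)[of 0 0] unfolding Y1 Y2 e21 by simp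
  have e11: "h 1 0 0 0 - h 1 1 0 0 * t - \<kappa> * t^2 = \<alpha>0 * (\<kappa> * t - 2 * \<kappa> * t) + 1"
    using xy(5)[of 0 0] unfolding Y1 Y2 e21 by simp
  define b where "b k = h 0 0 k 1" for k
  have b: "poly (Z 0 0 1) z = b 0 + b 1 * z + b 2 * z^2" for z
  proof (subst poly_eq_low)
    show "coeff (Z 0 0 1) i = 0" if "4 \<le> i" for i using that by (rule zw(6))
    have "b 3 = 0" using zw(8)[of 0 0] by (simp only: cZ[symmetric] b_def Z002) (simp add: eval_nat_numeral)
    thus "coeff (Z 0 0 1) 0 + coeff (Z 0 0 1) 1 * z + coeff (Z 0 0 1) 2 * z^2 + coeff (Z 0 0 1) 3 * z^3
      = b 0 + b 1 * z + b 2 * z^2" unfolding cZ b_def by simp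
  qed
  have b0: "b 0 = \<kappa> * \<alpha>5" using zw(4)[of 0 0] unfolding b Z002 by (simp add: pderiv_pCons)
  have b012: "b 0 + b 1 + b 2 = - \<kappa> * \<alpha>4" using zw(5)[of 0 0] unfolding b Z002 by (simp add: pderiv_pCons)
  have a: "Z 0 1 0 = [:h 0 1 0 0, 2 * \<kappa> * \<alpha>3:]"
  proof (rule poly_eqI)
    fix k :: nat
    consider "k = 0" | "k = 1" | "k = 2" | "k \<ge> 3" by linarith
    thus "coeff (Z 0 1 0) k = coeff [:h 0 1 0 0, 2 * \<kappa> * \<alpha>3:] k"
    proof cases
      case 1 thus ?thesis by (simp add: cZ[unfolded One_nat_def])
    next
      case 2 thus ?thesis using zw(10)[of 0 1] unfolding zero Z011
        by (simp add: numeral_2_eq_2)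
    next
      case 3 thus ?thesis using zw(9)[of 0 1] unfolding zero by (simp add: numeral_2_eq_2)
    next
      case 4 thus ?thesis using zw(7)[of k 0 1] by (simp add: coeff_pCons split: nat.splits)
    qed
  qed
  have "(h 0 1 0 0 - b 0 - \<alpha>2 * \<kappa>) + z * (2 * \<kappa> * \<alpha>3 + h 1 1 0 0 - b 1 + 2 * \<alpha>2 * \<kappa>) + z^2 * (\<kappa> * t - b 2) = 0" for z
  proof -
    have "h 0 1 0 0 + z * (2 * \<kappa> * \<alpha>3) + z * h 1 1 0 0 + z^2 * (\<kappa> * t) = b 0 + b 1 * z + b 2 * z^2
      - \<alpha>2 * (- \<kappa> + 2 * z * \<kappa>)"
      using Z_x0_y[of z] unfolding a b e21 e12 \<kappa>_def[symmetric] by simp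
    thus ?thesis by (simp add: algebra_simps)
  qed
  note q = quadratic_function_zero[OF this]
  have b2: "b 2 = \<kappa> * t" using q(3) by simp
  have b1: "b 1 = - \<kappa> * (\<alpha>4 + \<alpha>5) - \<kappa> * t" using b012 unfolding b0 b2 by (simp add: algebra_simps eq_neg_iff_add_eq_0)
  have e11': "h 1 1 0 0 = b 1 - 2 * \<kappa> * \<alpha>3 - 2 * \<alpha>2 * \<kappa>" using q(2) by (simp add: algebra_simps eq_neg_iff_add_eq_0)
  \<comment> \<open>the two expressions for the coefficient of \<open>x y\<close> agree\<close>
  have "\<kappa> * t * (\<alpha>0 + \<alpha>1 + 2 * \<alpha>2 + 2 * \<alpha>3 + \<alpha>4 + \<alpha>5) = 1"
    using e11 unfolding e10 e11' b1 by (simp add: algebra_simps power2_eq_square)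
  thus \<kappa>t: "\<kappa> * t = 1" unfolding sum by simp
  show "h 2 1 0 0 = 1" "h 1 0 0 0 = \<alpha>1" unfolding e21 e10 \<kappa>t by simp_all
  show "h 1 1 0 0 = - \<kappa> * (2 * \<alpha>2 + 2 * \<alpha>3 + \<alpha>4 + \<alpha>5) - 1"
    unfolding e11' b1 \<kappa>t by (simp add: algebra_simps)
  show Z001: "Z 0 0 1 = [:\<kappa> * \<alpha>5, - \<kappa> * (\<alpha>4 + \<alpha>5) - 1, 1:]"
    by (rule peq) (simp add: b[unfolded One_nat_def] b0 b1[unfolded One_nat_def] b2 \<kappa>t algebra_simps power2_eq_square)
  show "Z 0 1 0 = [:\<kappa> * (\<alpha>2 + \<alpha>5), 2 * \<kappa> * \<alpha>3:]"
    using q(1) unfolding a b0 by (simp add: algebra_simps)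
  show "Z 0 0 0 = [:h 0 0 0 0, \<alpha>3:]"
  proof (rule poly_eqI)
    fix k :: nat
    consider "k = 0" | "k = 1" | "k = 2" | "k \<ge> 3" by linarith
    thus "coeff (Z 0 0 0) k = coeff [:h 0 0 0 0, \<alpha>3:] k"
    proof cases
      case 1 thus ?thesis by (simp add: cZ)
    next
      case 2 thus ?thesis using zw(10)[of 0 0] unfolding Z001 Z002 by (simp add: eval_nat_numeral)
    next
      case 3 thus ?thesis using zw(9)[of 0 0] unfolding Z002 by (simp add: eval_nat_numeral)
    next
      case 4 thus ?thesis using zw(7)[of k 0 0] by (simp add: coeff_pCons split: nat.splits)
    qed
  qed
qed

end

section \<open>The Hamiltonian and the system\<close>

text \<open>Two Hamiltonians of the fifth Painleve type, in \<open>(x, y)\<close> and in \<open>(z, w)\<close>, coupled by the term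
  \<open>2 \<kappa> y z ((z - 1) w + \<alpha>3)\<close>; the value of \<open>\<kappa>\<close> is \<open>1/t\<close>.\<close>
definition coupled_hamiltonian :: "ct \<Rightarrow> ct \<Rightarrow> ct \<Rightarrow> ct \<Rightarrow> ct \<Rightarrow> ct \<Rightarrow> ct \<Rightarrow> pol4" where
  "coupled_hamiltonian c \<kappa> \<alpha>1 \<alpha>2 \<alpha>3 \<alpha>4 \<alpha>5 =
    [: [: [: [:c, \<alpha>1:],
             [:\<kappa> * (\<alpha>2 + \<alpha>5), - \<kappa> * (2 * \<alpha>2 + 2 * \<alpha>3 + \<alpha>4 + \<alpha>5) - 1, 1:],
             [:0, - \<kappa>, \<kappa>:] :],
          [: [:\<alpha>3:], [:2 * \<kappa> * \<alpha>3:] :] :],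
       [: [: [:\<kappa> * \<alpha>5:] :],
          [: [:- \<kappa> * (\<alpha>4 + \<alpha>5) - 1:], [:- 2 * \<kappa>:] :],
          [: [:1:], [:2 * \<kappa>:] :] :],
       [: 0, [: [:- \<kappa>:] :], [: [:\<kappa>:] :] :] :]"

context regular_hamiltonian
begin

lemma hamiltonian_eq:
  defines "\<kappa> \<equiv> 1 / t"
  assumes sum: "\<alpha>0 + \<alpha>1 + 2 * \<alpha>2 + 2 * \<alpha>3 + \<alpha>4 + \<alpha>5 = 1"
  shows "H = coupled_hamiltonian (h 0 0 0 0) \<kappa> \<alpha>1 \<alpha>2 \<alpha>3 \<alpha>4 \<alpha>5"
proof -
  note c = coefficients_determined[OF sum]
  have k: "h 2 2 0 0 = \<kappa>" unfolding \<kappa>_def by (rule nonzero_eq_divide_eq[OF t, THEN iffD2, OF c(1)])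
  note c = c(2-)[unfolded k]
  have x3: "h (Suc (Suc (Suc i))) j k l = 0" for i j k l by (simp add: h_eq_0_if_x3)
  have x2: "h (Suc (Suc 0)) j k l = (if k = 0 \<and> l = 0 then if j = 1 then 1 else if j = 2 then \<kappa> else 0 else 0)"
    for j k l
  proof -
    consider "k > 0 \<or> l > 0" | "k = 0" "l = 0" by blast
    thus ?thesis
    proof cases
      case 1 thus ?thesis using h_x2[OF 1] by (auto simp: numeral_2_eq_2)
    next
      case 2
      consider "j = 0" | "j = 1" | "j = 2" | "j \<ge> 3" by linarith
      thus ?thesis unfolding 2 numeral_2_eq_2[symmetric]
        by cases (use c(1,2) k y_degree_x12(2)[of j] in simp_all)
    qed
  qed
  have x1: "h (Suc 0) j k l = (if k = 0 \<and> l = 0 then if j = 0 then \<alpha>1 else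
      if j = 1 then - \<kappa> * (2 * \<alpha>2 + 2 * \<alpha>3 + \<alpha>4 + \<alpha>5) - 1 else if j = 2 then - \<kappa> else 0 else 0)"
    for j k l
  proof -
    have "h 1 j k l = (if k = 0 \<and> l = 0 then h 1 j 0 0 else 0)"
      using Z_x1'[of j l] cZ[of 1 j l k] by (cases k) (auto simp: coeff_pCons split: if_splits)
    moreover have "h 1 j 0 0 = (if j = 0 then \<alpha>1 else
        if j = 1 then - \<kappa> * (2 * \<alpha>2 + 2 * \<alpha>3 + \<alpha>4 + \<alpha>5) - 1 else if j = 2 then - \<kappa> else 0)"
    proof -
      consider "j = 0" | "j = 1" | "j = 2" | "j \<ge> 3" by linarith
      thus ?thesis
        by cases (simp_all only: c(3,4,5) y_degree_x12(1), simp_all)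
    qed
    ultimately show ?thesis by (simp only: One_nat_def)
  qed
  have x0: "h 0 j k l = coeff (if l = 0 then
        if j = 0 then [:h 0 0 0 0, \<alpha>3:] else if j = 1 then [:\<kappa> * (\<alpha>2 + \<alpha>5), 2 * \<kappa> * \<alpha>3:] else 0
      else if l = 1 then if j = 0 then [:\<kappa> * \<alpha>5, - \<kappa> * (\<alpha>4 + \<alpha>5) - 1, 1:]
        else if j = 1 then [:0, - 2 * \<kappa>, 2 * \<kappa>:] else 0
      else if l = 2 \<and> j = 0 then [:0, - \<kappa>, \<kappa>:] else 0) k" for j k l
  proof -
    consider "l = 0" | "l = 1" | "l = 2" | "l \<ge> 3" by linarith
    thus ?thesis
    proof cases
      case 4 thus ?thesis using zw(1)[of l 0 j] by (simp flip: cZ[of 0 j l k])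
    next
      case 3 show ?thesis unfolding 3 cZ[of 0 j 2 k, symmetric]
        using c(6) Z_x0_w2[of j] by (cases "j = 0") simp_all
    next
      case 2
      consider "j = 0" | "j = 1" | "j \<ge> 2" by linarith
      thus ?thesis unfolding 2 cZ[of 0 j 1 k, symmetric]
        by cases (use c(7,9) Z_x0_w1[of j] in simp_all)
    next
      case 1
      consider "j = 0" | "j = 1" | "j = 2" | "j \<ge> 3" by linarith
      thus ?thesis unfolding 1 cZ[of 0 j 0 k, symmetric]
        by cases (use c(8,10,11) Z_x0_w0[of j] in simp_all)
    qed
  qed
  (* h 0 0 0 0 occurs on both sides of x0; without a name for it, x0 would rewrite itself. *)
  define c0 where "c0 = h 0 0 0 0"
  note x0 = x0[folded c0_def]
  have cases: "n = 0 \<or> n = Suc 0 \<or> n = Suc (Suc 0) \<or> (\<exists>m. n = Suc (Suc (Suc m)))" for n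
    by presburger
  show ?thesis
  proof (intro poly_eqI)
    fix l k j i
    have "coeff (coeff (coeff (coeff H l) k) j) i = h i j k l" by (simp add: coeff4_def)
    also have "\<dots> = coeff (coeff (coeff (coeff (coupled_hamiltonian (h 0 0 0 0) \<kappa> \<alpha>1 \<alpha>2 \<alpha>3 \<alpha>4 \<alpha>5) l) k) j) i"
      unfolding coupled_hamiltonian_def
      using cases[of i] cases[of j] cases[of k] cases[of l]
      by (elim disjE exE; hypsubst) (simp_all add: x0 x1 x2 x3)
    finally show "coeff (coeff (coeff (coeff H l) k) j) i
      = coeff (coeff (coeff (coeff (coupled_hamiltonian (h 0 0 0 0) \<kappa> \<alpha>1 \<alpha>2 \<alpha>3 \<alpha>4 \<alpha>5) l) k) j) i" .
  qed
qed

end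

lemma ca_add: "ca (a + b) = ca a + ca b"
proof -
  have "ca (a + b) = to_fract ([:a:] + [:b:])" by simp
  thus ?thesis by (simp only: to_fract_add)
qed

lemma ca_double: "ca (2 * a) = 2 * ca a"
  by (simp only: mult_2 ca_add)

lemma ca_0: "ca 0 = 0" and ca_1: "ca 1 = 1"
  by (simp_all only: pCons_0_0 to_fract_0 one_pCons[symmetric] to_fract_1)

lemma cc_0: "cc 0 = 0" and cc_1: "cc 1 = 1"
  by (simp_all only: cc_def ca_0 ca_1 const4_hom)

lemma ddt_0: "ddt H 0 = 0"
  using ddt_rules(5)[of H 0] by (simp only: cc_0)

lemma ev_d_coupled_hamiltonian:
  "ev (d_x (coupled_hamiltonian c \<kappa> \<alpha>1 \<alpha>2 \<alpha>3 \<alpha>4 \<alpha>5)) x y z w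
    = \<alpha>1 - (\<kappa> * (2 * \<alpha>2 + 2 * \<alpha>3 + \<alpha>4 + \<alpha>5) + 1) * y + 2 * x * y - \<kappa> * y^2 + 2 * \<kappa> * x * y^2"
  "ev (d_y (coupled_hamiltonian c \<kappa> \<alpha>1 \<alpha>2 \<alpha>3 \<alpha>4 \<alpha>5)) x y z w
    = \<kappa> * (\<alpha>2 + \<alpha>5) - (\<kappa> * (2 * \<alpha>2 + 2 * \<alpha>3 + \<alpha>4 + \<alpha>5) + 1) * x + x^2
      - 2 * \<kappa> * x * y + 2 * \<kappa> * x^2 * y + 2 * \<kappa> * z * ((z - 1) * w + \<alpha>3)"
  "ev (d_z (coupled_hamiltonian c \<kappa> \<alpha>1 \<alpha>2 \<alpha>3 \<alpha>4 \<alpha>5)) x y z w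
    = \<alpha>3 - (\<kappa> * (\<alpha>4 + \<alpha>5) + 1) * w + 2 * z * w - \<kappa> * w^2 + 2 * \<kappa> * z * w^2
      + 2 * \<kappa> * y * (- w + 2 * z * w + \<alpha>3)"
  "ev (d_w (coupled_hamiltonian c \<kappa> \<alpha>1 \<alpha>2 \<alpha>3 \<alpha>4 \<alpha>5)) x y z w
    = \<kappa> * \<alpha>5 - (\<kappa> * (\<alpha>4 + \<alpha>5) + 1) * z + z^2 - 2 * \<kappa> * z * w + 2 * \<kappa> * z^2 * w
      + 2 * \<kappa> * y * z * (z - 1)"
  by (simp_all add: coupled_hamiltonian_def ev_def d_x_def d_y_def d_z_def d_w_def map_poly_pCons pderiv_pCons)
    (simp_all add: algebra_simps power2_eq_square)

lemma to_fract_eqI: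
  assumes "\<And>x y z w. has_value x y z w r (ev p x y z w)"
  shows "to_fract p = r"
  using assms has_value_to_fract by (intro has_value_eqI exI conjI)

lemma has_value_eq: "has_value x y z w q v \<Longrightarrow> u = v \<Longrightarrow> has_value x y z w q u"
  by simp

theorem theorem2p2:
  fixes \<alpha>0 \<alpha>1 \<alpha>2 \<alpha>3 \<alpha>4 \<alpha>5 :: complex
    and H :: pol4
  assumes sum_alpha: "\<alpha>0 + \<alpha>1 + 2 * \<alpha>2 + 2 * \<alpha>3 + \<alpha>4 + \<alpha>5 = 1"
    and A1: "total_degree_le H 6"
    and A2_0: "polynomial_hamiltonian_in H (1 / vx) (- ((vy + vt) * vx + cc \<alpha>0) * vx) vz vw"
    and A2_1: "polynomial_hamiltonian_in H (1 / vx) (- (vy * vx + cc \<alpha>1) * vx) vz vw"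
    and A2_2: "polynomial_hamiltonian_in H (- ((vx - vz) * vy - cc \<alpha>2) * vy) (1 / vy) vz (vw + vy)"
    and A2_3: "polynomial_hamiltonian_in H vx vy (1 / vz) (- (vw * vz + cc \<alpha>3) * vz)"
    and A2_4: "polynomial_hamiltonian_in H vx vy (- ((vz - 1) * vw - cc \<alpha>4) * vw) (1 / vw)"
    and A2_5: "polynomial_hamiltonian_in H vx vy (- (vz * vw - cc \<alpha>5) * vw) (1 / vw)"
  shows
    "to_fract (d_y H) =
       2 * vx ^ 2 * vy / vt + vx ^ 2 - 2 * vx * vy / vt
       - (1 + (2 * cc \<alpha>2 + 2 * cc \<alpha>3 + cc \<alpha>5 + cc \<alpha>4) / vt) * vx
       + (cc \<alpha>2 + cc \<alpha>5) / vt + 2 * vz * ((vz - 1) * vw + cc \<alpha>3) / vt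
     \<and> - to_fract (d_x H) =
       - 2 * vx * vy ^ 2 / vt + vy ^ 2 / vt - 2 * vx * vy
       + (1 + (2 * cc \<alpha>2 + 2 * cc \<alpha>3 + cc \<alpha>5 + cc \<alpha>4) / vt) * vy - cc \<alpha>1
     \<and> to_fract (d_w H) =
       2 * vz ^ 2 * vw / vt + vz ^ 2 - 2 * vz * vw / vt
       - (1 + (cc \<alpha>5 + cc \<alpha>4) / vt) * vz + cc \<alpha>5 / vt + 2 * vy * vz * (vz - 1) / vt
     \<and> - to_fract (d_z H) =
       - 2 * vz * vw ^ 2 / vt + vw ^ 2 / vt - 2 * vz * vw
       + (1 + (cc \<alpha>5 + cc \<alpha>4) / vt) * vw - cc \<alpha>3
       - 2 * vy * (- vw + 2 * vz * vw + cc \<alpha>3) / vt"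
proof -
  have t: "tt \<noteq> 0" unfolding to_fract_eq_0_iff by simp
  have s1: "ddt H 0 = const4 0" by (simp only: ddt_0 const4_hom)
  have v0: "has_value x y z w 0 0" for x y z w
    using has_value_const4[of x y z w 0] by (simp add: const4_hom)
  have s0: "ddt H vt = const4 1" by (simp add: ddt_vars const4_hom)
  have c1: "polynomial_hamiltonian_in H (1 / vx) (- ((vy + 0) * vx + cc \<alpha>1) * vx) vz vw"
    using A2_1 by simp
  have c4: "polynomial_hamiltonian_in H vx vy (- ((vz - cc 1) * vw - cc \<alpha>4) * vw) (1 / vw)"
    using A2_4 by (simp only: cc_1)
  have c5: "polynomial_hamiltonian_in H vx vy (- ((vz - cc 0) * vw - cc \<alpha>5) * vw) (1 / vw)"
    using A2_5 by (simp only: cc_0 diff_zero)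
  interpret regular_hamiltonian H tt "ca \<alpha>0" "ca \<alpha>1" "ca \<alpha>2" "ca \<alpha>3" "ca \<alpha>4" "ca \<alpha>5"
    by (unfold_locales)
      (rule A1 t chart_x[OF A2_0 s0 has_value_vars(5)] chart_x[OF c1 s1 v0] chart_y[OF A2_2] chart_z[OF A2_3]
        chart_w[OF c4, unfolded ca_0 ca_1] chart_w[OF c5, unfolded ca_0 ca_1])+
  have "ca (\<alpha>0 + \<alpha>1 + 2 * \<alpha>2 + 2 * \<alpha>3 + \<alpha>4 + \<alpha>5) = 1"
    unfolding sum_alpha by (rule ca_1)
  hence sum: "ca \<alpha>0 + ca \<alpha>1 + 2 * ca \<alpha>2 + 2 * ca \<alpha>3 + ca \<alpha>4 + ca \<alpha>5 = 1"
    by (simp only: ca_add ca_double)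
  define G where "G = coupled_hamiltonian (coeff4 H 0 0 0 0) (1 / tt) (ca \<alpha>1) (ca \<alpha>2) (ca \<alpha>3) (ca \<alpha>4) (ca \<alpha>5)"
  have H: "H = G" unfolding G_def by (rule hamiltonian_eq[OF sum])
  note vals = has_value_intros has_value_divide has_value_const4[where c = 1, unfolded const4_hom] t
  show ?thesis
    unfolding H to_fract_uminus[symmetric]
  proof (intro conjI to_fract_eqI, goal_cases)
    case (1 x y z w)
    show ?case by (rule has_value_eq, (rule vals)+) (simp only: G_def ev_d_coupled_hamiltonian, simp add: field_simps)
  next
    case (2 x y z w)
    show ?case by (rule has_value_eq, (rule vals)+) (simp only: G_def ev_simps ev_d_coupled_hamiltonian, simp add: field_simps)
  next
    case (3 x y z w)
    show ?case by (rule has_value_eq, (rule vals)+) (simp only: G_def ev_d_coupled_hamiltonian, simp add: field_simps)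
  next
    case (4 x y z w)
    show ?case by (rule has_value_eq, (rule vals)+) (simp only: G_def ev_simps ev_d_coupled_hamiltonian, simp add: field_simps)
  qed
qed

end
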